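(* Let $J$ be the two-sided ideal of $U(\mathbb{M})$ generated by $ce$ and $e^2$. In $U(\mathbb{M})/J$, writing a monomial for its coset, the following identities hold for all integers $i,j,k,\ell,p,q,r,s\ge 0$: \begin{align*} (a^i b^j d^\ell e)(a^p b^q d^s e)&=0,\\ (a^i b^j c^k d^\ell)(a^p b^q d^s e)&=\delta_{k0}\,a^{i+p}b^{j+q}d^{\ell+s}e,\\ (a^i b^j d^\ell e)(a^p b^q c^r d^s)&=\delta_{r0}\,a^{i+p}b^{j+q}d^{\ell+s}e,\\ (a^i b^j c^k d^\ell)(a^p b^q c^r d^s)&=\sum_{\mu=0}^{j}(-1)^\mu\mu!\binom{j}{\mu}\binom{p}{\mu}a^{i+p-\mu}b^{j+q-\mu}c^{k+r+\mu}d^{\ell+s}\\ &\quad+\delta_{k0}\delta_{r0}\left(\tfrac16 ijs-\tfrac16 i\ell q+\tfrac12 j\ell p+\tfrac13 jps-\tfrac13\ell pq\right)a^{i+p-1}b^{j+q-1}d^{\ell+s-1}e\\ &\quad-\delta_{k0}\delta_{r1}\,\ell\,a^{i+p}b^{j+q}d^{\ell+s-1}e. \end{align*}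
   Context: Let $\mathbb{F}$ be a field of characteristic $\ne 2,3$. $\mathbb{M}$ is the 5-dimensional nilpotent (non-Lie) Malcev algebra over $\mathbb{F}$ with basis $a,b,c,d,e$ and anticommutative product determined by $[a,b]=c$, $[c,d]=e$ (so $[b,a]=-c$, $[d,c]=-e$), all other products of basis elements being $0$. The universal nonassociative enveloping algebra is $U(\mathbb{M})=F(\mathbb{M})/R(\mathbb{M})$, where $F(\mathbb{M})$ is the unital free nonassociative $\mathbb{F}$-algebra on $\{a,b,c,d,e\}$ (with $\mathbb{M}$ viewed as the span of the generators) and $R(\mathbb{M})$ is the two-sided ideal generated by $fg-gf-[f,g]$, $(f,x,y)+(x,f,y)$, $(x,f,y)+(x,y,f)$ for all $f,g\in\mathbb{M}$, $x,y\in F(\mathbb{M})$; here $(x,y,z)=(xy)z-x(yz)$. By a theorem of Pérez-Izquierdo and Shestakov, $\mathbb{M}\to U(\mathbb{M})$ is injective and $U(\mathbb{M})$ has as a basis the left-tapped monomials $x_1(x_2(\cdots(x_{n-1}x_n)\cdots))$ with $n\ge 0$, $x_1\le\cdots\le x_n$ in the order $a<b<c<d<e$ (the empty monomial being $1$). Such a basis monomial with $i$ factors $a$, $j$ factors $b$, $k$ factors $c$, $\ell$ factors $d$, $m$ factors $e$ is written without parentheses as $a^ib^jc^kd^\ell e^m$. $\delta_{xy}$ is the Kronecker delta. Terms with zero coefficient are $0$ even if a negative exponent appears formally in them. *)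

theory Defs
  imports
    "HOL-Library.Poly_Mapping"
    "HOL-Analysis.Finite_Cartesian_Product"
begin

datatype gen = GA | GB | GC | GD | GE

lemma UNIV_gen: "UNIV = {GA, GB, GC, GD, GE}"
  using gen.exhaust by auto

instance gen :: finite
  by standard (simp add: UNIV_gen)

type_synonym 'k malcev = "'k ^ gen"

fun basis_bracket :: "gen \<Rightarrow> gen \<Rightarrow> 'k::field malcev" where
  "basis_bracket GA GB = axis GC 1"
| "basis_bracket GB GA = - axis GC 1"
| "basis_bracket GC GD = axis GE 1"
| "basis_bracket GD GC = - axis GE 1"
| "basis_bracket _ _ = 0"

definition bracket :: "'k::field malcev \<Rightarrow> 'k malcev \<Rightarrow> 'k malcev" where
  "bracket f g = (\<Sum>x\<in>UNIV. \<Sum>y\<in>UNIV. (f $ x * g $ y) *s basis_bracket x y)"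

datatype 'x magma = Gen 'x | Mag "'x magma" "'x magma"

text \<open>
  The free unital magma is the free magma with the empty word \<^const>\<open>None\<close> adjoined as unit;
  the unital free nonassociative algebra is its magma algebra. (The library product on
  \<^type>\<open>poly_mapping\<close> requires an associative index monoid, so it is not available here.)
\<close>

fun word_mult :: "'x magma option \<Rightarrow> 'x magma option \<Rightarrow> 'x magma option" where
  "word_mult None w = w"
| "word_mult (Some u) None = Some u"
| "word_mult (Some u) (Some v) = Some (Mag u v)"

type_synonym 'k free_alg = "gen magma option \<Rightarrow>\<^sub>0 'k"

definition free_one :: "'k::field free_alg" where
  "free_one = Poly_Mapping.single None 1"

definition free_gen :: "gen \<Rightarrow> 'k::field free_alg" where
  "free_gen x = Poly_Mapping.single (Some (Gen x)) 1"

definition free_scale :: "'k::field \<Rightarrow> 'k free_alg \<Rightarrow> 'k free_alg" where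
  "free_scale c = Poly_Mapping.map ((*) c)"

definition free_mult :: "'k::field free_alg \<Rightarrow> 'k free_alg \<Rightarrow> 'k free_alg" where
  "free_mult f g = (\<Sum>u\<in>Poly_Mapping.keys f. \<Sum>v\<in>Poly_Mapping.keys g.
     Poly_Mapping.single (word_mult u v) (Poly_Mapping.lookup f u * Poly_Mapping.lookup g v))"

text \<open>The inclusion of the Malcev algebra as the span of the generators.\<close>

definition malcev_incl :: "'k::field malcev \<Rightarrow> 'k free_alg" where
  "malcev_incl f = (\<Sum>x\<in>UNIV. free_scale (f $ x) (free_gen x))"

definition associator :: "('a \<Rightarrow> 'a \<Rightarrow> 'a::ab_group_add) \<Rightarrow> 'a \<Rightarrow> 'a \<Rightarrow> 'a \<Rightarrow> 'a" where
  "associator mul x y z = mul (mul x y) z - mul x (mul y z)"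

inductive_set ideal_gen ::
  "('k \<Rightarrow> 'a \<Rightarrow> 'a) \<Rightarrow> ('a \<Rightarrow> 'a \<Rightarrow> 'a) \<Rightarrow> 'a::ab_group_add set \<Rightarrow> 'a set"
  for scl mul S where
  base: "x \<in> S \<Longrightarrow> x \<in> ideal_gen scl mul S"
| zero: "0 \<in> ideal_gen scl mul S"
| diff: "x \<in> ideal_gen scl mul S \<Longrightarrow> y \<in> ideal_gen scl mul S \<Longrightarrow> x - y \<in> ideal_gen scl mul S"
| scale: "x \<in> ideal_gen scl mul S \<Longrightarrow> scl c x \<in> ideal_gen scl mul S"
| left: "x \<in> ideal_gen scl mul S \<Longrightarrow> mul y x \<in> ideal_gen scl mul S"
| right: "x \<in> ideal_gen scl mul S \<Longrightarrow> mul x y \<in> ideal_gen scl mul S"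

lemma ideal_gen_uminus:
  "x \<in> ideal_gen scl mul S \<Longrightarrow> - x \<in> ideal_gen scl mul S"
  using ideal_gen.diff[OF ideal_gen.zero, of x scl mul S] by simp

lemma ideal_gen_add:
  "x \<in> ideal_gen scl mul S \<Longrightarrow> y \<in> ideal_gen scl mul S \<Longrightarrow> x + y \<in> ideal_gen scl mul S"
  using ideal_gen.diff[of x scl mul S "- y"] ideal_gen_uminus[of y scl mul S] by simp

lemma ideal_gen_equivp: "equivp (\<lambda>x y. x - y \<in> ideal_gen scl mul S)"
proof (rule equivpI)
  show "reflp (\<lambda>x y. x - y \<in> ideal_gen scl mul S)"
    by (simp add: reflp_def ideal_gen.zero)
  show "symp (\<lambda>x y. x - y \<in> ideal_gen scl mul S)"
    unfolding symp_def using ideal_gen_uminus by fastforce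
  show "transp (\<lambda>x y. x - y \<in> ideal_gen scl mul S)"
    unfolding transp_def using ideal_gen_add by fastforce
qed

lemma ideal_gen_group_cong:
  assumes "x - x' \<in> ideal_gen scl mul S" "y - y' \<in> ideal_gen scl mul S"
  shows "x + y - (x' + y') \<in> ideal_gen scl mul S"
    and "x - y - (x' - y') \<in> ideal_gen scl mul S"
    and "- x - - x' \<in> ideal_gen scl mul S"
  using ideal_gen_add[OF assms] ideal_gen.diff[OF assms] ideal_gen_uminus[OF assms(1)]
  by (simp_all add: algebra_simps)

lemma ideal_gen_mult_cong:
  assumes "\<And>x y z. mul (x - y) z = mul x z - mul y z"
    and "\<And>x y z. mul z (x - y) = mul z x - mul z y"
    and "x - x' \<in> ideal_gen scl mul S" "y - y' \<in> ideal_gen scl mul S"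
  shows "mul x y - mul x' y' \<in> ideal_gen scl mul S"
proof -
  have "mul x y - mul x' y' = mul (x - x') y + mul x' (y - y')"
    by (simp add: assms(1,2))
  then show ?thesis
    by (simp add: assms(3,4) ideal_gen.left ideal_gen.right ideal_gen_add)
qed

lemma lookup_free_scale: "Poly_Mapping.lookup (free_scale c f) w = c * Poly_Mapping.lookup f w"
  by (simp add: free_scale_def Poly_Mapping.map.rep_eq when_def)

lemma free_scale_diff: "free_scale c (x - y) = free_scale c x - free_scale c y"
  by (rule poly_mapping_eqI) (simp add: lookup_free_scale Poly_Mapping.lookup_minus algebra_simps)

lemma free_mult_superset:
  assumes "finite S" "finite T" "Poly_Mapping.keys f \<subseteq> S" "Poly_Mapping.keys g \<subseteq> T"
  shows "free_mult f g = (\<Sum>u\<in>S. \<Sum>v\<in>T.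
     Poly_Mapping.single (word_mult u v) (Poly_Mapping.lookup f u * Poly_Mapping.lookup g v))"
proof -
  have "free_mult f g = (\<Sum>u\<in>Poly_Mapping.keys f. \<Sum>v\<in>T.
     Poly_Mapping.single (word_mult u v) (Poly_Mapping.lookup f u * Poly_Mapping.lookup g v))"
    unfolding free_mult_def
    by (intro sum.cong refl sum.mono_neutral_left assms) (auto simp: Poly_Mapping.in_keys_iff)
  also have "\<dots> = (\<Sum>u\<in>S. \<Sum>v\<in>T.
     Poly_Mapping.single (word_mult u v) (Poly_Mapping.lookup f u * Poly_Mapping.lookup g v))"
    by (intro sum.mono_neutral_left assms) (auto simp: Poly_Mapping.in_keys_iff)
  finally show ?thesis .
qed

lemma free_mult_diff_left: "free_mult (x - y) z = free_mult x z - free_mult y z"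
proof -
  let ?S = "Poly_Mapping.keys x \<union> Poly_Mapping.keys y"
  have "Poly_Mapping.keys (x - y) \<subseteq> ?S"
    by (auto simp: Poly_Mapping.in_keys_iff Poly_Mapping.lookup_minus)
  then show ?thesis
    by (simp add: free_mult_superset[of ?S "Poly_Mapping.keys z"] Poly_Mapping.lookup_minus left_diff_distrib
        Poly_Mapping.single_diff sum_subtractf)
qed

lemma free_mult_diff_right: "free_mult z (x - y) = free_mult z x - free_mult z y"
proof -
  let ?S = "Poly_Mapping.keys x \<union> Poly_Mapping.keys y"
  have "Poly_Mapping.keys (x - y) \<subseteq> ?S"
    by (auto simp: Poly_Mapping.in_keys_iff Poly_Mapping.lookup_minus)
  then show ?thesis
    by (simp add: free_mult_superset[of "Poly_Mapping.keys z" ?S] Poly_Mapping.lookup_minus right_diff_distrib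
        Poly_Mapping.single_diff sum_subtractf)
qed

definition env_rels :: "'k::field free_alg set" where
  "env_rels =
     {free_mult (malcev_incl f) (malcev_incl g) - free_mult (malcev_incl g) (malcev_incl f)
        - malcev_incl (bracket f g) | f g. True}
   \<union> {associator free_mult (malcev_incl f) x y + associator free_mult x (malcev_incl f) y
        | f x y. True}
   \<union> {associator free_mult x (malcev_incl f) y + associator free_mult x y (malcev_incl f)
        | f x y. True}"

definition env_ideal :: "'k::field free_alg set" where
  "env_ideal = ideal_gen free_scale free_mult env_rels"

quotient_type (overloaded) 'k env = "'k::field free_alg" / "\<lambda>x y. x - y \<in> env_ideal"
  unfolding env_ideal_def by (rule ideal_gen_equivp)

instantiation env :: (field) "{ab_group_add, one, times}"
begin

lift_definition zero_env :: "'a env" is 0 .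

lift_definition one_env :: "'a env" is free_one .

lift_definition plus_env :: "'a env \<Rightarrow> 'a env \<Rightarrow> 'a env" is "(+)"
  unfolding env_ideal_def by (rule ideal_gen_group_cong)

lift_definition minus_env :: "'a env \<Rightarrow> 'a env \<Rightarrow> 'a env" is "(-)"
  unfolding env_ideal_def by (rule ideal_gen_group_cong)

lift_definition uminus_env :: "'a env \<Rightarrow> 'a env" is uminus
  unfolding env_ideal_def by (rule ideal_gen_group_cong)

lift_definition times_env :: "'a env \<Rightarrow> 'a env \<Rightarrow> 'a env" is free_mult
  unfolding env_ideal_def
  by (rule ideal_gen_mult_cong[OF free_mult_diff_left free_mult_diff_right])

instance
  by standard (transfer, simp add: env_ideal_def ideal_gen.zero algebra_simps)+

end

lift_definition env_scale :: "'k::field \<Rightarrow> 'k env \<Rightarrow> 'k env" is free_scale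
  unfolding env_ideal_def by (metis free_scale_diff ideal_gen.scale)

lift_definition env_gen :: "gen \<Rightarrow> 'k::field env" is free_gen .

lemma env_scale_diff: "env_scale c (x - y) = env_scale c x - env_scale c y"
  by transfer (simp add: free_scale_diff env_ideal_def ideal_gen.zero)

lemma env_mult_diff_left: "(x - y) * z = x * z - y * (z :: 'k::field env)"
  by transfer (simp add: free_mult_diff_left env_ideal_def ideal_gen.zero)

lemma env_mult_diff_right: "z * (x - y) = z * x - z * (y :: 'k::field env)"
  by transfer (simp add: free_mult_diff_right env_ideal_def ideal_gen.zero)

text \<open>
  The left-tapped monomial \<open>a\<^sup>i b\<^sup>j c\<^sup>k d\<^sup>l e\<^sup>m\<close>, i.e. the right-nested product
  \<open>x\<^sub>1(x\<^sub>2(\<dots>(x\<^bsub>n-1\<^esub> x\<^sub>n)\<dots>))\<close> of its factors. The innermost factor \<open>1\<close> is the unit,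
  so it is harmless for \<open>n \<ge> 1\<close> and gives the empty monomial for \<open>n = 0\<close>.
\<close>

definition env_monom :: "nat \<Rightarrow> nat \<Rightarrow> nat \<Rightarrow> nat \<Rightarrow> nat \<Rightarrow> 'k::field env" where
  "env_monom i j k l m = foldr (*)
     (replicate i (env_gen GA) @ replicate j (env_gen GB) @ replicate k (env_gen GC)
       @ replicate l (env_gen GD) @ replicate m (env_gen GE)) 1"

definition J_ideal :: "'k::field env set" where
  "J_ideal = ideal_gen env_scale (*) {env_gen GC * env_gen GE, env_gen GE * env_gen GE}"

quotient_type (overloaded) 'k envJ = "'k::field env" / "\<lambda>x y. x - y \<in> J_ideal"
  unfolding J_ideal_def by (rule ideal_gen_equivp)

instantiation envJ :: (field) "{ab_group_add, one, times}"
begin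

lift_definition zero_envJ :: "'a envJ" is 0 .

lift_definition one_envJ :: "'a envJ" is 1 .

lift_definition plus_envJ :: "'a envJ \<Rightarrow> 'a envJ \<Rightarrow> 'a envJ" is "(+)"
  unfolding J_ideal_def by (rule ideal_gen_group_cong)

lift_definition minus_envJ :: "'a envJ \<Rightarrow> 'a envJ \<Rightarrow> 'a envJ" is "(-)"
  unfolding J_ideal_def by (rule ideal_gen_group_cong)

lift_definition uminus_envJ :: "'a envJ \<Rightarrow> 'a envJ" is uminus
  unfolding J_ideal_def by (rule ideal_gen_group_cong)

lift_definition times_envJ :: "'a envJ \<Rightarrow> 'a envJ \<Rightarrow> 'a envJ" is "(*)"
  unfolding J_ideal_def
  by (rule ideal_gen_mult_cong[OF env_mult_diff_left env_mult_diff_right])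

instance
  by standard (transfer, simp add: J_ideal_def ideal_gen.zero algebra_simps)+

end

lift_definition envJ_scale :: "'k::field \<Rightarrow> 'k envJ \<Rightarrow> 'k envJ"  (infixr \<open>\<cdot>\<close> 75) is env_scale
  unfolding J_ideal_def by (metis env_scale_diff ideal_gen.scale)

text \<open>
  The exponents are natural numbers, so an exponent that is formally
  negative is truncated to \<open>0\<close>; such exponents occur only in terms whose coefficient is zero.
\<close>

lift_definition mon :: "nat \<Rightarrow> nat \<Rightarrow> nat \<Rightarrow> nat \<Rightarrow> nat \<Rightarrow> 'k::field envJ" is env_monom .

end

(*
  The generators lie in the generalized alternative nucleus, so for generators f, g the map
  D(f,g) = ad [f,g] - 3 (f,g,-) is a derivation; since it vanishes on the algebra generators for all
  pairs except {a,b}, {a,d}, {b,d}, the element e is central and nuclear, c associates with every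
  generator, and (a,b,-), (a,d,-), (b,d,-) are 1/6, -1/6, 1/6 times e times the partial derivatives
  by d, b, a.  Modulo ce and e^2 the ideal generated by e behaves like commutative polynomials in
  a, b, d, and there 6 (f,u,y) is e times the Jacobian determinant of f, u, y for every generator f
  and all monomials u, y.  The multiplication table then follows from (fu)y = f(uy) + (f,u,y) by
  peeling off the leading generator of the left factor.
*)

theory Submission
  imports Defs
begin

section \<open>The generalized alternative nucleus\<close>

class nonassoc_ring_1 = ab_group_add + times + one +
  assumes na_distrib_right: "(x + y) * z = x * z + y * z"
    and na_distrib_left: "x * (y + z) = x * y + x * z"
    and na_mult_1_left [simp]: "1 * x = x"
    and na_mult_1_right [simp]: "x * 1 = x"
begin

lemma na_mult_zero_left [simp]: "0 * x = 0"
  using na_distrib_right[of 0 0 x] by simp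

lemma na_mult_zero_right [simp]: "x * 0 = 0"
  using na_distrib_left[of x 0 0] by simp

lemma na_mult_minus_left [simp]: "- x * y = - (x * y)"
  using na_distrib_right[of "- x" x y] by (simp add: eq_neg_iff_add_eq_0)

lemma na_mult_minus_right [simp]: "x * - y = - (x * y)"
  using na_distrib_left[of x "- y" y] by (simp add: eq_neg_iff_add_eq_0)

lemma na_left_diff_distrib: "(x - y) * z = x * z - y * z"
  using na_distrib_right[of x "- y" z] by simp

lemma na_right_diff_distrib: "x * (y - z) = x * y - x * z"
  using na_distrib_left[of x y "- z"] by simp

lemmas na_distribs = na_distrib_right na_distrib_left na_left_diff_distrib na_right_diff_distrib

end

abbreviation assoc :: "'a::nonassoc_ring_1 \<Rightarrow> 'a \<Rightarrow> 'a \<Rightarrow> 'a" where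
  "assoc \<equiv> associator (*)"

lemma assoc_def: "assoc x y z = (x * y) * z - x * (y * z)"
  by (simp add: associator_def)

lemma assoc_add:
  "assoc (x + x') y z = assoc x y z + assoc x' y z"
  "assoc x (y + y') z = assoc x y z + assoc x y' z"
  "assoc x y (z + z') = assoc x y z + assoc x y z'"
  by (simp_all add: assoc_def na_distribs algebra_simps)

lemma assoc_diff:
  "assoc (x - x') y z = assoc x y z - assoc x' y z"
  "assoc x (y - y') z = assoc x y z - assoc x y' z"
  "assoc x y (z - z') = assoc x y z - assoc x y z'"
  by (simp_all add: assoc_def na_distribs algebra_simps)

lemma assoc_one [simp]: "assoc 1 y z = 0" "assoc x 1 z = 0" "assoc x y 1 = 0"
  by (simp_all add: assoc_def)

definition comm :: "'a::nonassoc_ring_1 \<Rightarrow> 'a \<Rightarrow> 'a" where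
  "comm x y = x * y - y * x"

lemma comm_swap: "comm x y = - comm y x"
  by (simp add: comm_def)

lemma comm_zero [simp]: "comm 0 x = 0" "comm x 0 = 0" "comm x x = 0"
  by (simp_all add: comm_def)

lemma comm_one [simp]: "comm 1 x = 0" "comm x 1 = 0"
  by (simp_all add: comm_def)

lemma comm_add: "comm (x + y) z = comm x z + comm y z" "comm x (y + z) = comm x y + comm x z"
  by (simp_all add: comm_def na_distribs algebra_simps)

lemma comm_minus [simp]: "comm (- x) y = - comm x y" "comm x (- y) = - comm x y"
  by (simp_all add: comm_def)

definition alt_nucleus :: "'a::nonassoc_ring_1 set" where
  "alt_nucleus = {f. \<forall>x y. assoc f x y + assoc x f y = 0 \<and> assoc x f y + assoc x y f = 0}"

lemma alt_nucleusD:
  assumes "f \<in> alt_nucleus"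
  shows "assoc x f y = - assoc f x y" "assoc x y f = assoc f x y" "assoc x y f = - assoc x f y"
proof -
  have *: "assoc f x y + assoc x f y = 0" "assoc x f y + assoc x y f = 0"
    using assms by (auto simp: alt_nucleus_def)
  show "assoc x f y = - assoc f x y"
    using *(1) by (simp add: eq_neg_iff_add_eq_0 add.commute)
  show "assoc x y f = assoc f x y"
    using * by (metis add.commute add_left_imp_eq)
  show "assoc x y f = - assoc x f y"
    using *(2) by (simp add: eq_neg_iff_add_eq_0 add.commute)
qed

lemma alt_mult_left:
  assumes "f \<in> alt_nucleus"
  shows "f * (x * y) = (f * x) * y + (x * f) * y - x * (f * y)"
  using alt_nucleusD(1)[OF assms, of x y] by (simp add: assoc_def algebra_simps)

lemma alt_mult_right:
  assumes "f \<in> alt_nucleus"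
  shows "(x * y) * f = x * (f * y) + x * (y * f) - (x * f) * y"
  using alt_nucleusD(3)[OF assms, of x y] by (simp add: assoc_def algebra_simps)

lemma alt_left_nested:
  assumes "f \<in> alt_nucleus"
  shows "(f * x) * y = f * (x * y) + (x * y) * f - x * (y * f)"
  using alt_nucleusD(2)[OF assms, of x y] by (simp add: assoc_def algebra_simps)

lemma alt_right_nested:
  assumes "f \<in> alt_nucleus"
  shows "(x * f) * y = x * (f * y) + x * (y * f) - (x * y) * f"
  using alt_nucleusD(3)[OF assms, of x y] by (simp add: assoc_def algebra_simps)

lemma alt_assoc_swap:
  assumes "f \<in> alt_nucleus" "g \<in> alt_nucleus"
  shows "assoc f x g = - assoc f g x" "assoc g f x = - assoc f g x"
  using alt_nucleusD[OF assms(1)] alt_nucleusD[OF assms(2)] by metis+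

lemma alt_comm_mult:
  assumes "f \<in> alt_nucleus"
  shows "comm f (x * y) = comm f x * y + x * comm f y - assoc f x y - assoc f x y - assoc f x y"
  using alt_nucleusD[OF assms, of x y]
  by (simp add: comm_def assoc_def na_distribs algebra_simps)

lemma alt_commute_left:
  assumes "f \<in> alt_nucleus" "g \<in> alt_nucleus"
  shows "f * (g * x) = g * (f * x) + comm f g * x - assoc f g x - assoc f g x"
  using alt_assoc_swap(2)[OF assms, of x]
  by (simp add: comm_def assoc_def na_distribs algebra_simps)

lemma assoc_mult_middle:
  assumes "f \<in> alt_nucleus" "g \<in> alt_nucleus"
  shows "assoc f (g * u) y = assoc f g (u * y) + g * assoc f u y + assoc g u y * f - assoc g u (y * f)"
proof -
  have "assoc (g * u) y f = assoc g (u * y) f + g * assoc u y f + assoc g u y * f - assoc g u (y * f)"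
    by (simp add: assoc_def na_distribs algebra_simps)
  then show ?thesis
    unfolding alt_nucleusD(2)[OF assms(1)] .
qed

lemma alt_jacobi:
  assumes "f \<in> alt_nucleus" "g \<in> alt_nucleus" "h \<in> alt_nucleus"
  shows "comm (comm f g) h + comm (comm g h) f + comm (comm h f) g
    = assoc f g h + assoc f g h + assoc f g h + assoc f g h + assoc f g h + assoc f g h"
proof -
  note * = alt_nucleusD[OF assms(1)] alt_nucleusD[OF assms(2)] alt_nucleusD[OF assms(3)]
  have "comm (comm f g) h + comm (comm g h) f + comm (comm h f) g
    = assoc f g h + assoc g h f + assoc h f g - assoc g f h - assoc f h g - assoc h g f"
    by (simp add: comm_def assoc_def na_distribs algebra_simps)
  moreover have "assoc g h f = assoc f g h" using * by metis
  moreover have "assoc h f g = assoc f g h" using * by metis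
  moreover have "assoc g f h = - assoc f g h" using * by metis
  moreover have "assoc f h g = - assoc f g h" using * by metis
  moreover have "assoc h g f = - assoc f g h" using * by metis
  ultimately show ?thesis by simp
qed

definition inner_der :: "'a::nonassoc_ring_1 \<Rightarrow> 'a \<Rightarrow> 'a \<Rightarrow> 'a" where
  "inner_der f g x = comm (comm f g) x - assoc f g x - assoc f g x - assoc f g x"

lemma inner_der_operators:
  assumes "f \<in> alt_nucleus" "g \<in> alt_nucleus"
  shows "inner_der f g x = f * (g * x) - g * (f * x) + (f * (x * g) - (f * x) * g) + ((x * g) * f - (x * f) * g)"
proof -
  note * = alt_nucleusD[OF assms(1)] alt_nucleusD[OF assms(2)]
  have 1: "assoc g f x = - assoc f g x" using * by metis
  have 2: "assoc f x g = - assoc f g x" using * by metis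
  have 3: "assoc x f g = assoc f g x" using * by metis
  have 4: "assoc x g f = - assoc f g x" using * by metis
  have "f * (g * x) - g * (f * x) + (f * (x * g) - (f * x) * g) + ((x * g) * f - (x * f) * g)
    = comm (comm f g) x - assoc f g x + assoc g f x - assoc f x g + assoc x g f - assoc x f g"
    by (simp add: comm_def assoc_def na_distribs algebra_simps)
  then show ?thesis
    unfolding 1 2 3 4 by (simp add: inner_der_def algebra_simps)
qed

definition derivation :: "('a::nonassoc_ring_1 \<Rightarrow> 'a) \<Rightarrow> bool" where
  "derivation \<delta> \<longleftrightarrow> (\<forall>x y. \<delta> (x + y) = \<delta> x + \<delta> y) \<and> (\<forall>x y. \<delta> (x * y) = \<delta> x * y + x * \<delta> y)"

lemma inner_der_derivation:
  assumes "f \<in> alt_nucleus" "g \<in> alt_nucleus"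
  shows "derivation (inner_der f g)"
proof -
  note * = alt_nucleusD[OF assms(1)] alt_nucleusD[OF assms(2)]
  have 1: "(f * x) * g = f * (x * g) + g * (x * f) - (g * x) * f" for x
  proof -
    have "assoc f x g = - assoc g x f" using * by metis
    then show ?thesis by (simp add: assoc_def algebra_simps)
  qed
  have "inner_der f g (x * y) = inner_der f g x * y + x * inner_der f g y" for x y
  proof -
    note left_f = alt_mult_left[OF assms(1)] and left_g = alt_mult_left[OF assms(2)]
    note right_f = alt_mult_right[OF assms(1)] and right_g = alt_mult_right[OF assms(2)]
    have LL: "f * (g * (x * y)) - g * (f * (x * y))
      = (f * (g * x) + f * (x * g) + (g * x) * f + (x * g) * f
         - g * (f * x) - g * (x * f) - (f * x) * g - (x * f) * g) * y
        + x * (f * (g * y) - g * (f * y))"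
      by (simp add: left_f[of x y] left_g[of x y] left_f[of "g * x" y] left_f[of "x * g" y]
          left_f[of x "g * y"] left_g[of "f * x" y] left_g[of "x * f" y] left_g[of x "f * y"]
          na_distribs algebra_simps)
    have LR: "f * ((x * y) * g) - (f * (x * y)) * g
      = ((f * x) * g + (x * f) * g - f * (x * g) - (x * g) * f) * y
        + x * ((f * y) * g + g * (f * y) - f * (y * g) - f * (g * y))"
      by (simp add: left_f[of x y] right_g[of x y] left_f[of "x * g" y] left_f[of x "g * y"]
          left_f[of x "y * g"] right_g[of "f * x" y] right_g[of "x * f" y] right_g[of x "f * y"]
          na_distribs algebra_simps)
    have RR: "((x * y) * g) * f - ((x * y) * f) * g
      = ((x * g) * f - (x * f) * g) * y
        + x * (f * (g * y) + (g * y) * f + f * (y * g) + (y * g) * f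
            - g * (f * y) - g * (y * f) - (f * y) * g - (y * f) * g)"
      by (simp add: right_f[of x y] right_g[of x y] right_f[of "x * g" y] right_f[of x "g * y"]
          right_f[of x "y * g"] right_g[of "x * f" y] right_g[of x "f * y"] right_g[of x "y * f"]
          na_distribs algebra_simps)
    show ?thesis
      unfolding inner_der_operators[OF assms] LL LR RR
      unfolding 1
      by (simp add: na_distribs algebra_simps)
  qed
  moreover have "inner_der f g (x + y) = inner_der f g x + inner_der f g y" for x y
    by (simp add: inner_der_def assoc_add comm_add)
  ultimately show ?thesis
    by (simp add: derivation_def)
qed

lemma alt_inner_der_double:
  assumes "f \<in> alt_nucleus" "g \<in> alt_nucleus" "h \<in> alt_nucleus"
  shows "inner_der f g h + inner_der f g h = comm (comm f g) h - comm (comm g h) f - comm (comm h f) g"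
proof -
  have "inner_der f g h + inner_der f g h = comm (comm f g) h + comm (comm f g) h
    - (assoc f g h + assoc f g h + assoc f g h + assoc f g h + assoc f g h + assoc f g h)"
    by (simp add: inner_der_def algebra_simps)
  then show ?thesis
    unfolding alt_jacobi[OF assms, symmetric] by simp
qed

lemma derivation_one:
  assumes "derivation \<delta>"
  shows "\<delta> 1 = 0"
proof -
  have "\<delta> (1 * 1) = \<delta> 1 * 1 + 1 * \<delta> 1"
    using assms unfolding derivation_def by blast
  then show ?thesis by simp
qed

section \<open>Derivations and the central element\<close>

locale nonassoc_algebra = vector_space scale
  for scale :: "'k::field \<Rightarrow> 'a::nonassoc_ring_1 \<Rightarrow> 'a" (infixr \<open>*\<^sub>S\<close> 75) +
  assumes scale_mult_left [simp]: "(r *\<^sub>S x) * y = r *\<^sub>S (x * y)"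
    and scale_mult_right [simp]: "x * (r *\<^sub>S y) = r *\<^sub>S (x * y)"
begin

lemma assoc_scale [simp]:
  "assoc (r *\<^sub>S x) y z = r *\<^sub>S assoc x y z"
  "assoc x (r *\<^sub>S y) z = r *\<^sub>S assoc x y z"
  "assoc x y (r *\<^sub>S z) = r *\<^sub>S assoc x y z"
  by (simp_all add: assoc_def scale_right_diff_distrib)

lemma comm_scale [simp]: "comm (r *\<^sub>S x) y = r *\<^sub>S comm x y" "comm x (r *\<^sub>S y) = r *\<^sub>S comm x y"
  by (simp_all add: comm_def scale_right_diff_distrib)

lemma scale_two: "2 *\<^sub>S x = x + x"
  using scale_left_distrib[of 1 1 x] by simp

lemma scale_three: "3 *\<^sub>S x = x + x + x"
  using scale_left_distrib[of 2 1 x] by (simp add: scale_two)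

definition linear_derivation :: "('a \<Rightarrow> 'a) \<Rightarrow> bool" where
  "linear_derivation \<delta> \<longleftrightarrow> derivation \<delta> \<and> (\<forall>r x. \<delta> (r *\<^sub>S x) = r *\<^sub>S \<delta> x)"

lemma linear_derivationD:
  assumes "linear_derivation \<delta>"
  shows "\<delta> (x + y) = \<delta> x + \<delta> y" "\<delta> (x * y) = \<delta> x * y + x * \<delta> y" "\<delta> (r *\<^sub>S x) = r *\<^sub>S \<delta> x"
    "\<delta> 1 = 0"
  using assms derivation_one unfolding linear_derivation_def derivation_def by blast+

lemma linear_derivation_inner_der:
  assumes "f \<in> alt_nucleus" "g \<in> alt_nucleus"
  shows "linear_derivation (inner_der f g)"
  using inner_der_derivation[OF assms]
  by (simp add: linear_derivation_def inner_der_def scale_right_diff_distrib)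

lemma linear_derivation_scale:
  assumes "linear_derivation \<delta>"
  shows "linear_derivation (\<lambda>x. r *\<^sub>S \<delta> x)"
  using linear_derivationD[OF assms]
  by (simp add: linear_derivation_def derivation_def scale_right_distrib scale_left_commute)

lemma linear_derivation_zero: "linear_derivation (\<lambda>x. 0)"
  by (simp add: linear_derivation_def derivation_def)

end

locale malcev_enveloping = nonassoc_algebra scale
  for scale :: "'k::field \<Rightarrow> 'a::nonassoc_ring_1 \<Rightarrow> 'a" (infixr \<open>*\<^sub>S\<close> 75) +
  fixes a b c d e :: 'a
  assumes two_neq_0 [simp]: "(2 :: 'k) \<noteq> 0" and three_neq_0 [simp]: "(3 :: 'k) \<noteq> 0"
    and gens_alt: "{a, b, c, d, e} \<subseteq> alt_nucleus"
    and comm_gens: "comm a b = c" "comm c d = e" "comm a c = 0" "comm a d = 0" "comm a e = 0"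
      "comm b c = 0" "comm b d = 0" "comm b e = 0" "comm c e = 0" "comm d e = 0"
    and ce [simp]: "c * e = 0" and ee [simp]: "e * e = 0"
    and generated: "\<lbrakk>P 1; \<And>g. g \<in> {a, b, c, d, e} \<Longrightarrow> P g; \<And>x y. P x \<Longrightarrow> P y \<Longrightarrow> P (x + y);
      \<And>r x. P x \<Longrightarrow> P (r *\<^sub>S x); \<And>x y. P x \<Longrightarrow> P y \<Longrightarrow> P (x * y)\<rbrakk> \<Longrightarrow> P x"
begin

definition gens :: "'a set" where
  "gens = {a, b, c, d, e}"

lemma gens [simp]: "a \<in> gens" "b \<in> gens" "c \<in> gens" "d \<in> gens" "e \<in> gens"
  by (auto simp: gens_def)

lemma gens_alt_nucleus: "g \<in> gens \<Longrightarrow> g \<in> alt_nucleus"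
  using gens_alt by (auto simp: gens_def)

lemma abcde_alt_nucleus [simp]:
  "a \<in> alt_nucleus" "b \<in> alt_nucleus" "c \<in> alt_nucleus" "d \<in> alt_nucleus" "e \<in> alt_nucleus"
  by (simp_all add: gens_alt_nucleus)

lemma comm_gens_swap: "comm b a = - c" "comm d c = - e" "comm c a = 0" "comm d a = 0" "comm e a = 0"
      "comm c b = 0" "comm d b = 0" "comm e b = 0" "comm e c = 0" "comm e d = 0"
  using comm_swap[of b a] comm_swap[of d c] comm_swap[of c a] comm_swap[of d a] comm_swap[of e a]
    comm_swap[of c b] comm_swap[of d b] comm_swap[of e b] comm_swap[of e c] comm_swap[of e d]
  by (simp_all add: comm_gens)

lemmas comm_table [simp] = comm_gens comm_gens_swap

lemma double_eq_zero: "x + x = (0 :: 'a) \<longleftrightarrow> x = 0"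
  using scale_eq_0_iff[of 2 x] by (simp add: scale_two)

inductive_set nested :: "'a set" where
  one: "1 \<in> nested"
| add: "x \<in> nested \<Longrightarrow> y \<in> nested \<Longrightarrow> x + y \<in> nested"
| scale: "x \<in> nested \<Longrightarrow> r *\<^sub>S x \<in> nested"
| left: "g \<in> gens \<Longrightarrow> x \<in> nested \<Longrightarrow> g * x \<in> nested"
| right: "g \<in> gens \<Longrightarrow> x \<in> nested \<Longrightarrow> x * g \<in> nested"

lemma nested_diff: "x \<in> nested \<Longrightarrow> y \<in> nested \<Longrightarrow> x - y \<in> nested"
  using nested.add[of x "(- 1) *\<^sub>S y"] nested.scale[of y "- 1"] by simp

lemma nested_mult:
  assumes "x \<in> nested" "y \<in> nested"
  shows "x * y \<in> nested"
  using assms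
proof (induction arbitrary: y)
  case (left g x)
  then show ?case
    by (simp add: alt_left_nested gens_alt_nucleus nested.add nested_diff nested.left nested.right)
next
  case (right g x)
  then show ?case
    by (simp add: alt_right_nested gens_alt_nucleus nested.add nested_diff nested.left nested.right)
qed (auto simp: na_distribs intro: nested.intros)

lemma nested_all: "x \<in> nested"
proof (rule generated[where P = "\<lambda>x. x \<in> nested"])
  fix g assume "g \<in> {a, b, c, d, e}"
  then show "g \<in> nested"
    using nested.left[of g 1] nested.one by (simp add: gens_def)
qed (auto intro: nested.intros nested_mult)

lemma nested_induct [case_names one add scale left right]:
  assumes "P 1" "\<And>x y. P x \<Longrightarrow> P y \<Longrightarrow> P (x + y)" "\<And>r x. P x \<Longrightarrow> P (r *\<^sub>S x)"
    and "\<And>g x. g \<in> gens \<Longrightarrow> P x \<Longrightarrow> P (g * x)" "\<And>g x. g \<in> gens \<Longrightarrow> P x \<Longrightarrow> P (x * g)"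
  shows "P x"
  using nested_all[of x] by induction (use assms in auto)

lemma linear_derivation_eqI:
  assumes "linear_derivation \<delta>" "linear_derivation \<delta>'" "\<And>g. g \<in> gens \<Longrightarrow> \<delta> g = \<delta>' g"
  shows "\<delta> x = \<delta>' x"
  by (rule generated[where P = "\<lambda>x. \<delta> x = \<delta>' x"])
    (simp_all add: linear_derivationD[OF assms(1)] linear_derivationD[OF assms(2)] assms(3) flip: gens_def)

lemma inner_der_eq_zero:
  assumes "f \<in> gens" "g \<in> gens"
    and "\<And>h. h \<in> gens \<Longrightarrow> comm (comm f g) h - comm (comm g h) f - comm (comm h f) g = 0"
  shows "inner_der f g x = 0"
proof (rule linear_derivation_eqI[where \<delta> = "inner_der f g", OF _ linear_derivation_zero])
  fix h assume "h \<in> gens"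
  then show "inner_der f g h = 0"
    using alt_inner_der_double[of f g h] assms by (simp add: gens_alt_nucleus double_eq_zero)
qed (use assms in \<open>simp add: gens_alt_nucleus linear_derivation_inner_der\<close>)

lemma inner_der_center:
  assumes "g \<in> gens"
  shows "inner_der e g x = 0" "inner_der c g x = 0"
  using assms by (auto intro!: inner_der_eq_zero simp: gens_def)

lemma triple_assoc:
  "3 *\<^sub>S assoc f g x = comm (comm f g) x - inner_der f g x"
  by (simp add: inner_der_def scale_three)

lemma assoc_e_gen:
  assumes "g \<in> gens"
  shows "assoc e g x = 0"
proof -
  have "comm e g = 0" using assms by (auto simp: gens_def)
  then show ?thesis
    using triple_assoc[of e g x] assms by (simp add: inner_der_center)
qed

lemma comm_e [simp]: "comm e x = 0"
proof (induction x rule: nested_induct)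
  case (left g x)
  then have "comm e g = 0" by (auto simp: gens_def)
  with left show ?case
    by (simp add: alt_comm_mult assoc_e_gen)
next
  case (right g x)
  then have "comm e g = 0" by (auto simp: gens_def)
  moreover have "assoc e x g = 0"
    using right alt_assoc_swap(1)[of e g x] by (simp add: gens_alt_nucleus assoc_e_gen)
  ultimately show ?case
    using right by (simp add: alt_comm_mult)
qed (simp_all add: comm_add)

lemma e_commute: "x * e = e * x"
  using comm_e[of x] by (simp add: comm_def)

lemma e_assoc: "(e * x) * y = e * (x * y)"
proof -
  have "3 *\<^sub>S assoc e x y = 0"
    using alt_comm_mult[of e x y] by (simp add: scale_three algebra_simps)
  then show ?thesis by (simp add: assoc_def)
qed

lemma e_assoc': "x * (e * y) = e * (x * y)"
proof -
  have "assoc x e y = - assoc e x y" by (simp add: alt_nucleusD(1))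
  also have "\<dots> = 0" by (simp add: assoc_def e_assoc)
  finally show ?thesis by (simp add: assoc_def e_commute e_assoc)
qed

lemma ec [simp]: "e * c = 0"
  using e_commute[of c] by simp

lemma ee_mult [simp]: "e * (e * x) = 0"
  using e_assoc[of e x] by simp

lemma ec_mult [simp]: "e * (c * x) = 0"
  using e_assoc[of c x] e_commute[of c] by simp

lemma c_e_mult [simp]: "c * (e * x) = 0"
  by (simp add: e_assoc')

lemma assoc_e [simp]: "assoc (e * x) y z = e * assoc x y z" "assoc x (e * y) z = e * assoc x y z"
  "assoc x y (e * z) = e * assoc x y z"
  by (simp_all add: assoc_def e_assoc e_assoc' na_distribs)

lemma assoc_c_gen [simp]:
  assumes "g \<in> gens"
  shows "assoc c g x = 0" "assoc g c x = 0" "assoc c x g = 0"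
proof -
  have "comm (comm c g) x = 0" using assms by (auto simp: gens_def)
  then show *: "assoc c g x = 0"
    using triple_assoc[of c g x] assms by (simp add: inner_der_center)
  show "assoc g c x = 0" "assoc c x g = 0"
    using alt_assoc_swap[of c g x] assms * by (simp_all add: gens_alt_nucleus)
qed

text \<open>On basis monomials these are the partial derivatives by \<open>a\<close>, \<open>b\<close>, \<open>d\<close>, followed by multiplication by \<open>e\<close>.\<close>

definition da :: "'a \<Rightarrow> 'a" where "da x = (- 2) *\<^sub>S inner_der b d x"
definition db :: "'a \<Rightarrow> 'a" where "db x = 2 *\<^sub>S inner_der a d x"
definition dd :: "'a \<Rightarrow> 'a" where "dd x = 2 *\<^sub>S inner_der a b x"

lemma linear_derivation_partials: "linear_derivation da" "linear_derivation db" "linear_derivation dd"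
  unfolding da_def db_def dd_def
  by (intro linear_derivation_scale linear_derivation_inner_der abcde_alt_nucleus)+

lemmas partial_simps = linear_derivation_partials[THEN linear_derivationD(1)]
  linear_derivation_partials[THEN linear_derivationD(2)]
  linear_derivation_partials[THEN linear_derivationD(3)]
  linear_derivation_partials[THEN linear_derivationD(4)]

lemma partial_gens [simp]:
  "da a = e" "da b = 0" "da c = 0" "da d = 0" "da e = 0"
  "db a = 0" "db b = e" "db c = 0" "db d = 0" "db e = 0"
  "dd a = 0" "dd b = 0" "dd c = 0" "dd d = e" "dd e = 0"
  by (simp_all add: da_def db_def dd_def scale_two alt_inner_der_double)

lemma comm_c_eq: "comm c x = dd x"
proof (induction x rule: nested_induct)
  case (left g x)
  moreover from left have "comm c g = dd g" by (auto simp: gens_def)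
  ultimately show ?case
    by (simp add: alt_comm_mult partial_simps)
next
  case (right g x)
  moreover from right have "comm c g = dd g" by (auto simp: gens_def)
  ultimately show ?case
    by (simp add: alt_comm_mult partial_simps)
qed (simp_all add: comm_add partial_simps)

lemma six_neq_0 [simp]: "(6 :: 'k) \<noteq> 0"
  using mult_eq_0_iff[of "2 :: 'k" 3] by simp

lemma assoc_gens:
  "assoc a b x = (1/6) *\<^sub>S dd x" "assoc a d x = - (1/6) *\<^sub>S db x" "assoc b d x = (1/6) *\<^sub>S da x"
proof -
  have "6 *\<^sub>S assoc a b x = dd x"
  proof -
    have "6 *\<^sub>S assoc a b x = 2 *\<^sub>S (3 *\<^sub>S assoc a b x)" by simp
    also have "\<dots> = dd x + dd x - dd x"
      unfolding triple_assoc by (simp add: comm_c_eq scale_right_diff_distrib scale_two dd_def)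
    finally show ?thesis by simp
  qed
  moreover have "6 *\<^sub>S assoc a d x = - db x"
  proof -
    have "6 *\<^sub>S assoc a d x = 2 *\<^sub>S (3 *\<^sub>S assoc a d x)" by simp
    also have "\<dots> = - db x"
      unfolding triple_assoc by (simp add: scale_right_diff_distrib db_def)
    finally show ?thesis .
  qed
  moreover have "6 *\<^sub>S assoc b d x = da x"
  proof -
    have "6 *\<^sub>S assoc b d x = 2 *\<^sub>S (3 *\<^sub>S assoc b d x)" by simp
    also have "\<dots> = da x"
      unfolding triple_assoc by (simp add: scale_right_diff_distrib da_def)
    finally show ?thesis .
  qed
  moreover have "z = (1/6) *\<^sub>S w" if "6 *\<^sub>S z = w" for z w :: 'a
    using that by (metis scale_scale nonzero_divide_eq_eq scale_one six_neq_0)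
  ultimately show "assoc a b x = (1/6) *\<^sub>S dd x" "assoc a d x = - (1/6) *\<^sub>S db x"
    "assoc b d x = (1/6) *\<^sub>S da x"
    by fastforce+
qed

lemma assoc_gens_swap:
  "assoc b a x = - (1/6) *\<^sub>S dd x" "assoc d a x = (1/6) *\<^sub>S db x" "assoc d b x = - (1/6) *\<^sub>S da x"
  using alt_assoc_swap(2)[of a b x] alt_assoc_swap(2)[of a d x] alt_assoc_swap(2)[of b d x]
  by (simp_all add: assoc_gens)

lemma assoc_alt_same:
  fixes f x :: 'a
  assumes "f \<in> alt_nucleus"
  shows "assoc f f x = 0"
  using alt_assoc_swap(2)[OF assms assms, of x] double_eq_zero[of "assoc f f x"]
  by (metis add.right_inverse)

lemma e_multiple_partial: "\<exists>z. da x = e * z" "\<exists>z. db x = e * z" "\<exists>z. dd x = e * z"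
proof -
  have "\<exists>z. \<delta> x = e * z"
    if \<delta>: "linear_derivation \<delta>" and gens: "\<And>g. g \<in> gens \<Longrightarrow> \<delta> g = 0 \<or> \<delta> g = e" for \<delta>
  proof (rule generated[where P = "\<lambda>x. \<exists>z. \<delta> x = e * z"])
    show "\<exists>z. \<delta> 1 = e * z"
      by (metis linear_derivationD(4)[OF \<delta>] na_mult_zero_right)
    show "\<exists>z. \<delta> g = e * z" if "g \<in> {a, b, c, d, e}" for g
      using gens that by (metis gens_def na_mult_1_right na_mult_zero_right)
    show "\<exists>z. \<delta> (x + y) = e * z" if "\<exists>z. \<delta> x = e * z" "\<exists>z. \<delta> y = e * z" for x y
      using that by (metis linear_derivationD(1)[OF \<delta>] na_distrib_left)
    show "\<exists>z. \<delta> (r *\<^sub>S x) = e * z" if "\<exists>z. \<delta> x = e * z" for r x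
      using that by (metis linear_derivationD(3)[OF \<delta>] scale_mult_right)
    show "\<exists>z. \<delta> (x * y) = e * z" if "\<exists>z. \<delta> x = e * z" "\<exists>z. \<delta> y = e * z" for x y
      using that by (metis linear_derivationD(2)[OF \<delta>] na_distrib_left e_assoc e_assoc')
  qed
  note * = this
  show "\<exists>z. da x = e * z" "\<exists>z. db x = e * z" "\<exists>z. dd x = e * z"
    by (rule *; auto simp: linear_derivation_partials gens_def)+
qed

lemma e_multiple_assoc_gens:
  assumes "f \<in> gens" "g \<in> gens"
  shows "\<exists>z. assoc f g x = e * z"
proof -
  obtain z1 z2 z3 where z: "da x = e * z1" "db x = e * z2" "dd x = e * z3"
    using e_multiple_partial by metis
  have "assoc f g x \<in> {0, (1/6) *\<^sub>S da x, (1/6) *\<^sub>S db x, (1/6) *\<^sub>S dd x,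
      - ((1/6) *\<^sub>S da x), - ((1/6) *\<^sub>S db x), - ((1/6) *\<^sub>S dd x)}"
    using assms by (auto simp: gens_def assoc_gens assoc_gens_swap assoc_alt_same assoc_e_gen
        alt_assoc_swap(2)[of e])
  moreover have "(1/6) *\<^sub>S (e * w) = e * ((1/6) *\<^sub>S w)" "- ((1/6) *\<^sub>S (e * w)) = e * - ((1/6) *\<^sub>S w)" for w
    by simp_all
  moreover have "0 = e * 0" by simp
  ultimately show ?thesis
    unfolding z by (metis (no_types) insert_iff empty_iff)
qed

lemma e_multiple_kill: 
  assumes "\<exists>z. x = e * z"
  shows "e * x = 0" "c * x = 0" "x * c = 0" "x * (c * y) = 0"
proof -
  obtain z where z: "x = e * z" using assms ..
  show "e * x = 0" "c * x = 0" by (simp_all add: z)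
  have "x * c = z * (e * c)" by (simp only: z e_assoc e_assoc')
  then show "x * c = 0" by simp
  have "x * (c * y) = z * (e * (c * y))" by (simp only: z e_assoc e_assoc')
  then show "x * (c * y) = 0" by simp
qed

lemma e_comm_kill: "g \<in> gens \<Longrightarrow> h \<in> gens \<Longrightarrow> e * (comm g h * x) = 0"
  by (auto simp: gens_def e_assoc)

lemma e_comm:
  assumes "f \<in> gens"
  shows "e * comm f x = 0"
proof (induction x rule: nested_induct)
  case (left g x)
  have "e * (g * comm f x) = 0"
    using left e_assoc'[of g "comm f x"] by simp
  with left show ?case
    using assms by (simp add: alt_comm_mult gens_alt_nucleus na_distribs e_comm_kill
        e_multiple_kill(1)[OF e_multiple_assoc_gens])
next
  case (right g x)
  have "e * (comm f x * g) = 0"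
    using right e_assoc[of "comm f x" g] by simp
  moreover have "e * (x * comm f g) = 0"
    using assms right by (auto simp: gens_def e_assoc'[symmetric])
  moreover have "e * assoc f x g = 0"
    using assms right
    by (simp add: alt_assoc_swap(1)[of f g x] gens_alt_nucleus e_multiple_kill(1)[OF e_multiple_assoc_gens])
  ultimately show ?case
    using assms by (simp add: alt_comm_mult gens_alt_nucleus na_distribs)
qed (simp_all add: comm_add na_distribs)

lemma e_left_commute:
  assumes "f \<in> gens" "g \<in> gens"
  shows "e * (f * (g * x)) = e * (g * (f * x))"
  using assms
  by (simp add: alt_commute_left[of f g x] gens_alt_nucleus na_distribs e_comm_kill
      e_multiple_kill(1)[OF e_multiple_assoc_gens])

inductive_set words :: "'a set" where
  one: "1 \<in> words"
| mult: "g \<in> gens \<Longrightarrow> u \<in> words \<Longrightarrow> g * u \<in> words"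

lemma e_multiple_assoc_word:
  assumes "u \<in> words" "f \<in> gens"
  shows "\<exists>z. assoc f u y = e * z"
  using assms
proof (induction arbitrary: f y)
  case one
  show ?case by (intro exI[of _ 0]) simp
next
  case (mult g u)
  obtain z1 z2 z3 z4 where "assoc f g (u * y) = e * z1" "assoc f u y = e * z2" "assoc g u y = e * z3"
    "assoc g u (y * f) = e * z4"
    using mult e_multiple_assoc_gens by metis
  then have "assoc f (g * u) y = e * (z1 + g * z2 + z3 * f - z4)"
    using mult assoc_mult_middle[of f g u y]
    by (simp add: gens_alt_nucleus na_distribs e_assoc e_assoc')
  then show ?case ..
qed

lemma e_assoc_word [simp]: "u \<in> words \<Longrightarrow> f \<in> gens \<Longrightarrow> e * assoc f u y = 0"
  using e_multiple_assoc_word e_multiple_kill(1) by blast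

lemma partial_word_c: "da (u * (c * y)) = 0" "db (u * (c * y)) = 0" "dd (u * (c * y)) = 0"
  by (simp_all add: partial_simps e_multiple_kill e_multiple_partial)

lemma assoc_gens_word_c: "f \<in> gens \<Longrightarrow> g \<in> gens \<Longrightarrow> assoc f g (u * (c * y)) = 0"
  by (auto simp: gens_def assoc_gens assoc_gens_swap assoc_alt_same assoc_e_gen
      alt_assoc_swap(2)[of e] partial_word_c)

lemma assoc_word_c [simp]:
  assumes "u \<in> words" "f \<in> gens"
  shows "assoc f u (c * y) = 0"
  using assms
proof (induction arbitrary: f y)
  case (mult g u)
  have "(c * y) * f = c * (y * f)"
    using assoc_c_gen(3)[OF mult.prems, of y] by (simp add: assoc_def)
  with mult show ?case
    by (simp add: assoc_mult_middle gens_alt_nucleus assoc_gens_word_c)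
qed simp

lemma assoc_c_word [simp]:
  assumes "u \<in> words"
  shows "assoc c u y = 0"
  using assms
proof (induction arbitrary: y)
  case (mult g u)
  obtain z where z: "dd y = e * z" using e_multiple_partial by blast
  have "y * c = c * y - e * z"
    using comm_c_eq[of y] unfolding z comm_def by (simp add: algebra_simps)
  moreover have "assoc g u y * c = 0"
    using mult e_multiple_assoc_word e_multiple_kill(3) by blast
  ultimately show ?case
    using mult by (simp add: assoc_mult_middle gens_alt_nucleus assoc_diff)
qed simp

text \<open>All commutators with monomials lie in this subspace, and \<open>(f, u, -)\<close> kills it for generators \<open>f\<close> and monomials \<open>u\<close>, so such associators can be computed as if \<open>a\<close>, \<open>b\<close>, \<open>d\<close> commuted.\<close>

definition ce_part :: "'a set" where
  "ce_part = {c * x + e * y | x y. True}"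

lemma ce_part_intros:
  "c * x \<in> ce_part" "e * x \<in> ce_part" "0 \<in> ce_part"
  unfolding ce_part_def by (auto, (metis add.right_neutral add.left_neutral na_mult_zero_right)+)

lemma ce_part_minus_intros: "- (c * x) \<in> ce_part" "- (e * x) \<in> ce_part"
  using ce_part_intros(1)[of "- x"] ce_part_intros(2)[of "- x"] by simp_all

lemma ce_part_add: "x \<in> ce_part \<Longrightarrow> y \<in> ce_part \<Longrightarrow> x + y \<in> ce_part"
proof -
  assume "x \<in> ce_part" "y \<in> ce_part"
  then obtain x1 x2 y1 y2 where "x = c * x1 + e * x2" "y = c * y1 + e * y2"
    unfolding ce_part_def by blast
  then have "x + y = c * (x1 + y1) + e * (x2 + y2)"
    by (simp add: na_distribs algebra_simps)
  then show ?thesis unfolding ce_part_def by blast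
qed

lemma ce_part_minus: "x \<in> ce_part \<Longrightarrow> - x \<in> ce_part"
proof -
  assume "x \<in> ce_part"
  then obtain x1 x2 where "x = c * x1 + e * x2"
    unfolding ce_part_def by blast
  then have "- x = c * (- x1) + e * (- x2)"
    by (simp add: na_distribs algebra_simps)
  then show ?thesis unfolding ce_part_def by blast
qed

lemma ce_part_diff: "x \<in> ce_part \<Longrightarrow> y \<in> ce_part \<Longrightarrow> x - y \<in> ce_part"
  using ce_part_add[of x "- y"] ce_part_minus[of y] by simp

lemma ce_part_mult:
  assumes "g \<in> gens" "x \<in> ce_part"
  shows "g * x \<in> ce_part"
proof -
  obtain x1 x2 where x: "x = c * x1 + e * x2"
    using assms unfolding ce_part_def by blast
  have "comm g c * x1 \<in> ce_part"
    using assms by (auto simp: gens_def intro: ce_part_intros ce_part_minus_intros)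
  moreover have "g * x = c * (g * x1) + comm g c * x1 + e * (g * x2)"
    using assms by (simp add: x na_distribs e_assoc' alt_commute_left[of g c] gens_alt_nucleus)
  ultimately show ?thesis
    by (simp add: ce_part_intros ce_part_add)
qed

lemma assoc_word_ce_part: "u \<in> words \<Longrightarrow> f \<in> gens \<Longrightarrow> z \<in> ce_part \<Longrightarrow> assoc f u z = 0"
  by (auto simp: ce_part_def assoc_add)

lemma comm_word_ce_part:
  assumes "u \<in> words" "f \<in> gens"
  shows "comm f u \<in> ce_part"
  using assms
proof induction
  case (mult g u)
  have "assoc f g u \<in> ce_part"
    using mult e_multiple_assoc_gens[of f g u] by (auto intro: ce_part_intros)
  moreover have "comm f g * u \<in> ce_part"
    using mult by (auto simp: gens_def intro: ce_part_intros ce_part_minus_intros)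
  ultimately show ?case
    using mult by (simp add: alt_comm_mult gens_alt_nucleus ce_part_add ce_part_diff ce_part_mult)
qed (simp add: ce_part_intros)

lemma assoc_word_step:
  assumes "u \<in> words" "y \<in> words" "f \<in> gens" "g \<in> gens"
  shows "assoc f (g * u) y = assoc f g (u * y) + g * assoc f u y + f * assoc g u y - assoc g u (f * y)"
proof -
  obtain z where z: "assoc g u y = e * z"
    using e_multiple_assoc_word assms by blast
  have "assoc g u y * f = f * assoc g u y"
  proof -
    have "e * (f * z) = e * (z * f)"
      using e_comm[OF assms(3), of z] by (simp add: comm_def na_distribs)
    then show ?thesis by (simp add: z e_assoc e_assoc')
  qed
  moreover have "assoc g u (y * f) = assoc g u (f * y)"
  proof -
    have "y * f = f * y - comm f y" by (simp add: comm_def)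
    then show ?thesis
      using assms by (simp add: assoc_diff assoc_word_ce_part comm_word_ce_part)
  qed
  ultimately show ?thesis
    using assms by (simp add: assoc_mult_middle gens_alt_nucleus)
qed

section \<open>Monomials\<close>

definition M :: "nat \<Rightarrow> nat \<Rightarrow> nat \<Rightarrow> nat \<Rightarrow> 'a" where
  "M i j k l = ((*) a ^^ i) (((*) b ^^ j) (((*) c ^^ k) (((*) d ^^ l) 1)))"

definition E :: "nat \<Rightarrow> nat \<Rightarrow> nat \<Rightarrow> 'a" where
  "E i j l = e * M i j 0 l"

lemma M_0 [simp]: "M 0 0 0 0 = 1"
  by (simp add: M_def)

lemma M_Suc:
  "M (Suc i) j k l = a * M i j k l" "M 0 (Suc j) k l = b * M 0 j k l"
  "M 0 0 (Suc k) l = c * M 0 0 k l" "M 0 0 0 (Suc l) = d * M 0 0 0 l"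
  by (simp_all add: M_def)

lemma M_induct [case_names 0 d c b a]:
  assumes "P 0 0 0 0" "\<And>l. P 0 0 0 l \<Longrightarrow> P 0 0 0 (Suc l)" "\<And>k l. P 0 0 k l \<Longrightarrow> P 0 0 (Suc k) l"
    "\<And>j k l. P 0 j k l \<Longrightarrow> P 0 (Suc j) k l" "\<And>i j k l. P i j k l \<Longrightarrow> P (Suc i) j k l"
  shows "P i j k (l :: nat)"
proof -
  have "P 0 0 0 l" by (induction l) (use assms in auto)
  then have "P 0 0 k l" by (induction k) (use assms in auto)
  then have "P 0 j k l" by (induction j) (use assms in auto)
  then show "P i j k l" by (induction i) (use assms in auto)
qed

lemma M_words [simp]: "M i j k l \<in> words"
  by (induction i j k l rule: M_induct) (auto simp: M_Suc intro: words.intros)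

lemma a_M: "a * M i j k l = M (Suc i) j k l"
  by (simp add: M_Suc)

lemma c_M: "c * M i j k l = M i j (Suc k) l"
proof (induction i j k l rule: M_induct)
  case (a i j k l)
  then show ?case using alt_commute_left[of c a "M i j k l"] by (simp add: M_Suc)
next
  case (b j k l)
  then show ?case using alt_commute_left[of c b "M 0 j k l"] by (simp add: M_Suc)
qed (simp_all add: M_Suc)

lemma e_M: "e * M i j k l = (if k = 0 then E i j l else 0)"
  by (cases k) (simp_all add: E_def flip: c_M)

lemma ce_part_E [simp]: "E i j l \<in> ce_part"
  by (simp add: E_def ce_part_intros)

lemma e_E [simp]: "e * E i j l = 0" "c * E i j l = 0"
  by (simp_all add: E_def)

lemma a_E [simp]: "a * E i j l = E (Suc i) j l"
  by (simp add: E_def M_Suc e_assoc')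

lemma E_Suc: "E (Suc i) j l = a * E i j l" "E 0 (Suc j) l = b * E 0 j l" "E 0 0 (Suc l) = d * E 0 0 l"
  by (simp_all add: E_def M_Suc e_assoc')

lemma gen_a_E: "g \<in> gens \<Longrightarrow> g * (a * E i j l) = a * (g * E i j l)"
  unfolding E_def using e_left_commute[of g a] by (simp add: e_assoc')

lemma gen_b_E: "g \<in> gens \<Longrightarrow> g * (b * E i j l) = b * (g * E i j l)"
  unfolding E_def using e_left_commute[of g b] by (simp add: e_assoc')

lemma b_E [simp]: "b * E i j l = E i (Suc j) l"
proof (induction i)
  case (Suc i)
  then show ?case by (simp add: E_Suc(1) gen_a_E del: a_E)
qed (simp add: E_Suc)

lemma d_E [simp]: "d * E i j l = E i j (Suc l)"
proof (induction i)
  case 0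
  show ?case
  proof (induction j)
    case (Suc j)
    then show ?case by (simp add: E_Suc(2) gen_b_E del: b_E)
  qed (simp add: E_Suc)
next
  case (Suc i)
  then show ?case by (simp add: E_Suc(1) gen_a_E del: a_E)
qed

lemma da_M: "da (M i j k l) = of_bool (k = 0) *\<^sub>S of_nat i *\<^sub>S E (i - 1) j l"
proof (induction i j k l rule: M_induct)
  case (a i j k l)
  have step: "da (M (Suc i) j k l) = e * M i j k l + a * da (M i j k l)"
    by (simp add: M_Suc partial_simps)
  show ?case
    unfolding step a e_M by (cases i) (simp_all add: na_distribs scale_left_distrib scale_two)
qed (simp_all add: M_Suc partial_simps)

lemma db_M: "db (M i j k l) = of_bool (k = 0) *\<^sub>S of_nat j *\<^sub>S E i (j - 1) l"
proof (induction i j k l rule: M_induct)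
  case (b j k l)
  have step: "db (M 0 (Suc j) k l) = e * M 0 j k l + b * db (M 0 j k l)"
    by (simp add: M_Suc partial_simps)
  show ?case
    unfolding step b e_M by (cases j) (simp_all add: na_distribs scale_left_distrib scale_two)
qed (simp_all add: M_Suc partial_simps)

lemma dd_M: "dd (M i j k l) = of_bool (k = 0) *\<^sub>S of_nat l *\<^sub>S E i j (l - 1)"
proof (induction i j k l rule: M_induct)
  case (d l)
  have step: "dd (M 0 0 0 (Suc l)) = e * M 0 0 0 l + d * dd (M 0 0 0 l)"
    by (simp add: M_Suc partial_simps)
  show ?case
    unfolding step d e_M by (cases l) (simp_all add: na_distribs scale_left_distrib scale_two)
qed (simp_all add: M_Suc partial_simps)

lemma scale_third: "(1/6) *\<^sub>S x + (1/6) *\<^sub>S x = (1/3) *\<^sub>S x"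
proof -
  have "(1/6 + 1/6 :: 'k) = 1/3" by (simp add: field_simps)
  then show ?thesis by (simp flip: scale_left_distrib)
qed

lemma b_M: "b * M p q r s = M p (Suc q) r s - of_nat p *\<^sub>S M (p - 1) q (Suc r) s
    + (of_bool (r = 0) * (1/3 * of_nat (p * s))) *\<^sub>S E (p - 1) q (s - 1)"
proof (induction p)
  case (Suc p)
  have step: "b * M (Suc p) q r s = a * (b * M p q r s) - M p q (Suc r) s + (1/3) *\<^sub>S dd (M p q r s)"
    using alt_commute_left[of b a "M p q r s"]
    by (simp add: M_Suc(1) assoc_gens_swap c_M flip: scale_third)
  have pred: "of_nat p *\<^sub>S M (Suc (p - 1)) q (Suc r) s = of_nat p *\<^sub>S M p q (Suc r) s"
    "(of_bool (r = 0) * (1/3 * of_nat (p * s))) *\<^sub>S E (Suc (p - 1)) q (s - 1)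
      = (of_bool (r = 0) * (1/3 * of_nat (p * s))) *\<^sub>S E p q (s - 1)"
    by (cases p; simp)+
  show ?case
    unfolding step Suc na_distribs scale_mult_right a_M a_E pred dd_M
    by (simp add: algebra_simps)
qed (simp add: M_Suc)

lemma d_M: "d * M p q r s = M p q r (Suc s)
    - (of_bool (r = 0) * (1/3 * of_nat (p * q))) *\<^sub>S E (p - 1) (q - 1) s
    - of_bool (r = 1) *\<^sub>S E p q s"
proof (induction p)
  case 0
  have *: "d * M 0 0 r s = M 0 0 r (Suc s) - of_bool (r = 1) *\<^sub>S E 0 0 s"
  proof (induction r)
    case (Suc r)
    have "d * M 0 0 (Suc r) s = c * (d * M 0 0 r s) - e * M 0 0 r s"
      using alt_commute_left[of d c "M 0 0 r s"] by (simp add: M_Suc(3))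
    then show ?case by (simp add: Suc e_M c_M na_distribs)
  qed (simp add: M_Suc)
  show ?case
  proof (induction q)
    case (Suc q)
    have "d * M 0 (Suc q) r s = b * (d * M 0 q r s)"
      using alt_commute_left[of d b "M 0 q r s"] by (simp add: M_Suc(2) assoc_gens_swap da_M)
    then show ?case by (simp add: Suc M_Suc(2) na_distribs)
  qed (simp add: *)
next
  case (Suc p)
  have step: "d * M (Suc p) q r s = a * (d * M p q r s) - (1/3) *\<^sub>S db (M p q r s)"
    using alt_commute_left[of d a "M p q r s"]
    by (simp add: M_Suc(1) assoc_gens_swap flip: scale_third)
  have pred: "(of_bool (r = 0) * (1/3 * of_nat (p * q))) *\<^sub>S E (Suc (p - 1)) (q - 1) s
      = (of_bool (r = 0) * (1/3 * of_nat (p * q))) *\<^sub>S E p (q - 1) s"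
    by (cases p) simp_all
  show ?case
    unfolding step Suc na_distribs scale_mult_right a_M a_E pred db_M
    by (simp add: algebra_simps)
qed

lemma e_M_M: "e * (M i j k l * M p q r s) = of_bool (k = 0 \<and> r = 0) *\<^sub>S E (i + p) (j + q) (l + s)"
proof -
  have step: "e * ((g * u) * y) = g * (e * (u * y))" if "g \<in> gens" "u \<in> words" for g u y
  proof -
    have "e * ((g * u) * y) = e * assoc g u y + e * (g * (u * y))"
      by (simp add: assoc_def na_distribs)
    then show ?thesis using that by (simp add: e_assoc')
  qed
  show ?thesis
    by (induction i j k l rule: M_induct) (simp_all add: M_Suc step e_M)
qed

lemma E_M: "E i j l * M p q r s = of_bool (r = 0) *\<^sub>S E (i + p) (j + q) (l + s)"
  by (simp add: E_def[of i] e_assoc e_M_M)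

lemma M_E: "M i j k l * E p q s = of_bool (k = 0) *\<^sub>S E (i + p) (j + q) (l + s)"
  by (simp add: E_def[of p] e_assoc' e_M_M)

lemma E_E: "E i j l * E p q s = 0"
  by (simp add: E_def[of i] e_assoc M_E)

lemma assoc_M_Suc [simp]: "f \<in> gens \<Longrightarrow> u \<in> words \<Longrightarrow> assoc f u (M p q (Suc r) s) = 0"
  by (simp flip: c_M)

lemma assoc_E [simp]: "f \<in> gens \<Longrightarrow> u \<in> words \<Longrightarrow> assoc f u (E p q s) = 0"
  by (simp add: assoc_word_ce_part)

lemma partial_M_M:
  "da (M 0 0 0 l * M p q 0 s) = of_nat p *\<^sub>S E (p - 1) q (l + s)"
  "db (M 0 0 0 l * M p q 0 s) = of_nat q *\<^sub>S E p (q - 1) (l + s)"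
  "dd (M 0 j 0 l * M p q 0 s) = of_nat (l + s) *\<^sub>S E p (j + q) (l + s - 1)"
proof -
  show "da (M 0 0 0 l * M p q 0 s) = of_nat p *\<^sub>S E (p - 1) q (l + s)"
    "db (M 0 0 0 l * M p q 0 s) = of_nat q *\<^sub>S E p (q - 1) (l + s)"
    by (simp_all add: partial_simps da_M db_M M_E E_M)
  have "of_nat l *\<^sub>S E p (j + q) (l - 1 + s) = of_nat l *\<^sub>S E p (j + q) (l + s - 1)"
    by (cases l) simp_all
  moreover have "of_nat s *\<^sub>S E p (j + q) (l + (s - 1)) = of_nat s *\<^sub>S E p (j + q) (l + s - 1)"
    by (cases s) simp_all
  ultimately show "dd (M 0 j 0 l * M p q 0 s) = of_nat (l + s) *\<^sub>S E p (j + q) (l + s - 1)"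
    by (auto simp: partial_simps dd_M M_E E_M scale_left_distrib)
qed

lemma assoc_M_step:
  assumes "f \<in> gens" "y \<in> words"
  shows "assoc f (M (Suc i) j k l) y
      = assoc f a (M i j k l * y) + a * assoc f (M i j k l) y + f * assoc a (M i j k l) y - assoc a (M i j k l) (f * y)"
    "assoc f (M 0 (Suc j) k l) y
      = assoc f b (M 0 j k l * y) + b * assoc f (M 0 j k l) y + f * assoc b (M 0 j k l) y - assoc b (M 0 j k l) (f * y)"
    "assoc f (M 0 0 0 (Suc l)) y
      = assoc f d (M 0 0 0 l * y) + d * assoc f (M 0 0 0 l) y + f * assoc d (M 0 0 0 l) y - assoc d (M 0 0 0 l) (f * y)"
  using assms by (simp_all add: M_Suc assoc_word_step)

lemma assoc_d_M: "assoc d (M 0 0 0 l) (M p q 0 s) = 0"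
proof (induction l arbitrary: s)
  case (Suc l)
  have "assoc d (M 0 0 0 (Suc l)) (M p q 0 s) = - assoc d (M 0 0 0 l) (M p q 0 (Suc s))"
    using Suc by (simp add: assoc_M_step assoc_alt_same d_M assoc_diff)
  then show ?case by (simp add: Suc)
qed simp

lemma assoc_b_M: "assoc b (M 0 j 0 l) (M p q 0 s)
    = (1/6 * of_nat (l * p)) *\<^sub>S E (p - 1) (j + q) (l + s - 1)"
proof (induction j arbitrary: p q)
  case 0
  show ?case
  proof (induction l arbitrary: s)
    case (Suc l)
    have step: "assoc b (M 0 0 0 (Suc l)) (M p q 0 s)
      = (1/6) *\<^sub>S da (M 0 0 0 l * M p q 0 s) + d * assoc b (M 0 0 0 l) (M p q 0 s)"
      by (simp add: assoc_M_step assoc_gens assoc_d_M b_M assoc_diff assoc_add)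
    have pred: "(1/6 * of_nat (l * p)) *\<^sub>S E (p - 1) (0 + q) (Suc (l + s - 1))
      = (1/6 * of_nat (l * p)) *\<^sub>S E (p - 1) q (l + s)"
      by (cases l) simp_all
    show ?case
      unfolding step Suc partial_M_M scale_mult_right d_E pred by (simp add: algebra_simps)
  qed simp
next
  case (Suc j)
  have step: "assoc b (M 0 (Suc j) 0 l) (M p q 0 s) = b * assoc b (M 0 j 0 l) (M p q 0 s)
      + b * assoc b (M 0 j 0 l) (M p q 0 s) - assoc b (M 0 j 0 l) (M p (Suc q) 0 s)"
    by (simp add: assoc_M_step assoc_alt_same b_M assoc_diff assoc_add)
  show ?case
    unfolding step Suc scale_mult_right b_E by simp
qed

lemma assoc_a_M: "assoc a (M i j 0 l) (M p q 0 s)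
    = (1/6 * (of_nat (j * s) - of_nat (l * q))) *\<^sub>S E (i + p) (j + q - 1) (l + s - 1)"
proof (induction i arbitrary: p)
  case 0
  show ?case
  proof (induction j arbitrary: q)
    case 0
    show ?case
    proof (induction l arbitrary: s)
      case (Suc l)
      have step: "assoc a (M 0 0 0 (Suc l)) (M p q 0 s)
        = - (1/6) *\<^sub>S db (M 0 0 0 l * M p q 0 s) + d * assoc a (M 0 0 0 l) (M p q 0 s)"
        by (simp add: assoc_M_step assoc_gens assoc_d_M a_M)
      have pred: "(1/6 * (of_nat (0 * s) - of_nat (l * q))) *\<^sub>S E (0 + p) (0 + q - 1) (Suc (l + s - 1))
        = (1/6 * (of_nat (0 * s) - of_nat (l * q))) *\<^sub>S E p (q - 1) (l + s)"
        by (cases l) simp_all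
      show ?case
        unfolding step Suc partial_M_M scale_mult_right d_E pred by (simp add: algebra_simps)
    qed simp
  next
    case (Suc j)
    have step: "assoc a (M 0 (Suc j) 0 l) (M p q 0 s)
      = (1/6) *\<^sub>S dd (M 0 j 0 l * M p q 0 s) + b * assoc a (M 0 j 0 l) (M p q 0 s)
        + a * assoc b (M 0 j 0 l) (M p q 0 s) - assoc b (M 0 j 0 l) (M (Suc p) q 0 s)"
      by (simp add: assoc_M_step assoc_gens a_M)
    have pred: "(1/6 * (of_nat (j * s) - of_nat (l * q))) *\<^sub>S E (0 + p) (Suc (j + q - 1)) (l + s - 1)
        = (1/6 * (of_nat (j * s) - of_nat (l * q))) *\<^sub>S E p (j + q) (l + s - 1)"
      "(1/6 * of_nat (l * p)) *\<^sub>S E (Suc (p - 1)) (j + q) (l + s - 1)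
        = (1/6 * of_nat (l * p)) *\<^sub>S E p (j + q) (l + s - 1)"
      by (cases j; cases q; simp) (cases p; simp)
    show ?case
      unfolding step Suc assoc_b_M partial_M_M scale_mult_right a_E b_E pred
      by (simp add: algebra_simps)
  qed
next
  case (Suc i)
  have step: "assoc a (M (Suc i) j 0 l) (M p q 0 s) = a * assoc a (M i j 0 l) (M p q 0 s)
      + a * assoc a (M i j 0 l) (M p q 0 s) - assoc a (M i j 0 l) (M (Suc p) q 0 s)"
    by (simp add: assoc_M_step(1)[of _ _ i] assoc_alt_same a_M)
  show ?case
    unfolding step Suc scale_mult_right a_E by simp
qed

end

lemma na_sum_distrib_left: "x * sum f A = (\<Sum>\<mu>\<in>A. x * f \<mu> :: 'a::nonassoc_ring_1)"
  by (induction A rule: infinite_finite_induct) (simp_all add: na_distribs)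

section \<open>Products of monomials\<close>

definition mult_coeff :: "nat \<Rightarrow> nat \<Rightarrow> nat \<Rightarrow> 'k::field" where
  "mult_coeff j p \<mu> = (- 1) ^ \<mu> * of_nat (fact \<mu>) * of_nat (j choose \<mu>) * of_nat (p choose \<mu>)"

lemma mult_coeff_0 [simp]: "mult_coeff j p 0 = 1"
  by (simp add: mult_coeff_def)

lemma mult_coeff_eq_0: "j < \<mu> \<or> p < \<mu> \<Longrightarrow> mult_coeff j p \<mu> = 0"
  by (auto simp: mult_coeff_def binomial_eq_0)

lemma mult_coeff_Suc_Suc: "mult_coeff (Suc j) p (Suc \<mu>) = mult_coeff j p (Suc \<mu>) - mult_coeff j p \<mu> * of_nat (p - \<mu>)"
proof -
  have *: "(p choose \<mu>) * (p - \<mu>) = Suc \<mu> * (p choose Suc \<mu>)"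
    by (metis binomial_absorb_comp binomial_absorption mult.commute)
  have "mult_coeff j p \<mu> * of_nat (p - \<mu>)
      = (- 1) ^ \<mu> * of_nat (fact \<mu>) * of_nat (j choose \<mu>) * (of_nat ((p choose \<mu>) * (p - \<mu>)) :: 'a)"
    by (simp add: mult_coeff_def)
  then show ?thesis
    unfolding * by (simp add: mult_coeff_def algebra_simps)
qed

context malcev_enveloping
begin

lemma mult_coeff_sum_Suc:
  "(\<Sum>\<mu>\<le>Suc j. mult_coeff (Suc j) p \<mu> *\<^sub>S F \<mu>)
    = (\<Sum>\<mu>\<le>j. mult_coeff j p \<mu> *\<^sub>S F \<mu>) - (\<Sum>\<mu>\<le>j. (mult_coeff j p \<mu> * of_nat (p - \<mu>)) *\<^sub>S F (Suc \<mu>))"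
proof -
  have "(\<Sum>\<mu>\<le>Suc j. mult_coeff (Suc j) p \<mu> *\<^sub>S F \<mu>)
      = F 0 + (\<Sum>\<mu>\<le>j. mult_coeff j p (Suc \<mu>) *\<^sub>S F (Suc \<mu>))
        - (\<Sum>\<mu>\<le>j. (mult_coeff j p \<mu> * of_nat (p - \<mu>)) *\<^sub>S F (Suc \<mu>))"
    by (simp only: sum.atMost_Suc_shift mult_coeff_Suc_Suc scale_left_diff_distrib sum_subtractf mult_coeff_0 scale_one
        add_diff_eq)
  also have "F 0 + (\<Sum>\<mu>\<le>j. mult_coeff j p (Suc \<mu>) *\<^sub>S F (Suc \<mu>)) = (\<Sum>\<mu>\<le>Suc j. mult_coeff j p \<mu> *\<^sub>S F \<mu>)"
    by (simp only: sum.atMost_Suc_shift mult_coeff_0 scale_one)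
  also have "\<dots> = (\<Sum>\<mu>\<le>j. mult_coeff j p \<mu> *\<^sub>S F \<mu>)"
    by (simp add: mult_coeff_eq_0)
  finally show ?thesis .
qed

lemma assoc_M_c:
  assumes "f \<in> gens" "y \<in> words"
  shows "assoc f (M i j (Suc k) l) y = 0"
proof -
  have "c * assoc f (M i j k l) y = 0"
    using assms by (intro e_multiple_kill(2) e_multiple_assoc_word) auto
  then show ?thesis
    using assms by (simp add: assoc_word_step flip: c_M)
qed

lemma assoc_a_M_M: "assoc a (M i j k l) (M p q r s)
    = (of_bool (k = 0) * of_bool (r = 0) * (1/6 * (of_nat (j * s) - of_nat (l * q))))
        *\<^sub>S E (i + p) (j + q - 1) (l + s - 1)"
  by (cases k; cases r) (simp_all add: assoc_M_c assoc_a_M)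

lemma assoc_b_M_M: "assoc b (M 0 j k l) (M p q r s)
    = (of_bool (k = 0) * of_bool (r = 0) * (1/6 * of_nat (l * p))) *\<^sub>S E (p - 1) (j + q) (l + s - 1)"
  by (cases k; cases r) (simp_all add: assoc_M_c assoc_b_M)

lemma assoc_d_M_M: "assoc d (M 0 0 0 l) (M p q r s) = 0"
  by (cases r) (simp_all add: assoc_d_M)

lemma mult_eq_assoc: "(x * y) * z = x * (y * z) + assoc x y z" for x y z :: 'a
  by (simp add: assoc_def)

lemma M_d_mult: "M 0 0 0 l * M p q r s = M p q r (l + s)
    - (of_bool (r = 0) * (1/3 * of_nat (l * p * q))) *\<^sub>S E (p - 1) (q - 1) (l + s - 1)
    - (of_bool (r = 1) * of_nat l) *\<^sub>S E p q (l + s - 1)"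
proof (induction l)
  case (Suc l)
  have step: "M 0 0 0 (Suc l) * M p q r s = d * (M 0 0 0 l * M p q r s)"
    by (simp add: M_Suc(4) mult_eq_assoc assoc_d_M_M)
  have pred: "(of_bool (r = 0) * (1/3 * of_nat (l * p * q))) *\<^sub>S E (p - 1) (q - 1) (Suc (l + s - 1))
      = (of_bool (r = 0) * (1/3 * of_nat (l * p * q))) *\<^sub>S E (p - 1) (q - 1) (l + s)"
    "(of_bool (r = 1) * of_nat l) *\<^sub>S E p q (Suc (l + s - 1)) = (of_bool (r = 1) * of_nat l) *\<^sub>S E p q (l + s)"
    by (cases l; simp)+
  show ?case
    unfolding step Suc na_distribs scale_mult_right d_E pred d_M
    by (simp add: algebra_simps)
qed simp

lemma M_c_mult: "M 0 0 k l * M p q r s = M p q (k + r) (l + s)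
    - (of_bool (k = 0) * of_bool (r = 0) * (1/3 * of_nat (l * p * q))) *\<^sub>S E (p - 1) (q - 1) (l + s - 1)
    - (of_bool (k = 0) * of_bool (r = 1) * of_nat l) *\<^sub>S E p q (l + s - 1)"
proof (induction k)
  case (Suc k)
  have step: "M 0 0 (Suc k) l * M p q r s = c * (M 0 0 k l * M p q r s)"
    by (simp add: M_Suc(3) mult_eq_assoc)
  show ?case
    unfolding step Suc by (simp add: na_distribs c_M)
qed (simp add: M_d_mult)

lemma M_b_mult: "M 0 j k l * M p q r s
    = (\<Sum>\<mu>\<le>j. mult_coeff j p \<mu> *\<^sub>S M (p - \<mu>) (j + q - \<mu>) (k + r + \<mu>) (l + s))
      + (of_bool (k = 0) * of_bool (r = 0)
          * (1/2 * of_nat (j * l * p) + 1/3 * of_nat (j * p * s) - 1/3 * of_nat (l * p * q)))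
          *\<^sub>S E (p - 1) (j + q - 1) (l + s - 1)
      - (of_bool (k = 0) * of_bool (r = 1) * of_nat l) *\<^sub>S E p (j + q) (l + s - 1)"
proof (induction j)
  case (Suc j)
  define F where "F = (\<lambda>\<mu>. M (p - \<mu>) (Suc j + q - \<mu>) (k + r + \<mu>) (l + s))"
  let ?\<delta> = "of_bool (k = 0) * of_bool (r = 0) :: 'k"
  let ?x = "1/2 * of_nat (j * l * p) + 1/3 * of_nat (j * p * s) - 1/3 * of_nat (l * p * q) :: 'k"
  have step: "M 0 (Suc j) k l * M p q r s = b * (M 0 j k l * M p q r s)
      + (?\<delta> * (1/6 * of_nat (l * p))) *\<^sub>S E (p - 1) (j + q) (l + s - 1)"
    by (simp add: M_Suc(2) mult_eq_assoc assoc_b_M_M)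
  have "b * (mult_coeff j p \<mu> *\<^sub>S M (p - \<mu>) (j + q - \<mu>) (k + r + \<mu>) (l + s))
      = mult_coeff j p \<mu> *\<^sub>S F \<mu> - (mult_coeff j p \<mu> * of_nat (p - \<mu>)) *\<^sub>S F (Suc \<mu>)
        + (if \<mu> = 0 then (?\<delta> * (1/3 * of_nat (p * (l + s)))) *\<^sub>S E (p - 1) (j + q) (l + s - 1) else 0)"
    if "\<mu> \<le> j" for \<mu>
  proof -
    have "Suc (j + q - \<mu>) = Suc j + q - \<mu>" using that by simp
    then show ?thesis
      by (auto simp: b_M F_def scale_right_distrib scale_right_diff_distrib of_bool_def)
  qed
  then have main: "b * (\<Sum>\<mu>\<le>j. mult_coeff j p \<mu> *\<^sub>S M (p - \<mu>) (j + q - \<mu>) (k + r + \<mu>) (l + s))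
      = (\<Sum>\<mu>\<le>Suc j. mult_coeff (Suc j) p \<mu> *\<^sub>S F \<mu>)
        + (?\<delta> * (1/3 * of_nat (p * (l + s)))) *\<^sub>S E (p - 1) (j + q) (l + s - 1)"
    unfolding mult_coeff_sum_Suc na_sum_distrib_left
    by (simp add: sum.distrib sum_subtractf sum.delta')
  have pred: "(?\<delta> * ?x) *\<^sub>S E (p - 1) (Suc (j + q - 1)) (l + s - 1)
      = (?\<delta> * ?x) *\<^sub>S E (p - 1) (j + q) (l + s - 1)"
    by (cases j; cases q) simp_all
  have coeff: "1/6 * of_nat (l * p) + 1/3 * of_nat (p * (l + s)) + ?x
      = 1/2 * of_nat (Suc j * l * p) + 1/3 * of_nat (Suc j * p * s) - 1/3 * of_nat (l * p * q)"
  proof -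
    have *: "1/3 = (2/6 :: 'k)" "1/2 = (3/6 :: 'k)" by (simp_all add: field_simps)
    have half: "1/2 = 1/6 + (1/3 :: 'k)" by (simp only: * add_divide_distrib[symmetric]) simp
    show ?thesis unfolding half by (simp add: algebra_simps)
  qed
  have "M 0 (Suc j) k l * M p q r s = (\<Sum>\<mu>\<le>Suc j. mult_coeff (Suc j) p \<mu> *\<^sub>S F \<mu>)
      + (?\<delta> * (1/6 * of_nat (l * p) + 1/3 * of_nat (p * (l + s)) + ?x)) *\<^sub>S E (p - 1) (j + q) (l + s - 1)
      - (of_bool (k = 0) * of_bool (r = 1) * of_nat l) *\<^sub>S E p (Suc (j + q)) (l + s - 1)"
    unfolding step Suc na_distribs main scale_mult_right b_E pred distrib_left scale_left_distrib
    by (simp only: add_ac diff_conv_add_uminus)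
  then show ?case
    unfolding coeff by (simp add: F_def)
qed (simp add: M_c_mult)

lemma M_M_mult: "M i j k l * M p q r s
    = (\<Sum>\<mu>\<le>j. mult_coeff j p \<mu> *\<^sub>S M (i + p - \<mu>) (j + q - \<mu>) (k + r + \<mu>) (l + s))
      + (of_bool (k = 0) * of_bool (r = 0)
          * (1/6 * of_nat (i * j * s) - 1/6 * of_nat (i * l * q) + 1/2 * of_nat (j * l * p)
             + 1/3 * of_nat (j * p * s) - 1/3 * of_nat (l * p * q)))
          *\<^sub>S E (i + p - 1) (j + q - 1) (l + s - 1)
      - (of_bool (k = 0) * of_bool (r = 1) * of_nat l) *\<^sub>S E (i + p) (j + q) (l + s - 1)"
proof (induction i)
  case (Suc i)
  let ?\<delta> = "of_bool (k = 0) * of_bool (r = 0) :: 'k"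
  let ?x = "1/6 * of_nat (i * j * s) - 1/6 * of_nat (i * l * q) + 1/2 * of_nat (j * l * p)
    + 1/3 * of_nat (j * p * s) - 1/3 * of_nat (l * p * q) :: 'k"
  have step: "M (Suc i) j k l * M p q r s = a * (M i j k l * M p q r s)
      + (?\<delta> * (1/6 * (of_nat (j * s) - of_nat (l * q)))) *\<^sub>S E (i + p) (j + q - 1) (l + s - 1)"
    by (simp add: M_Suc(1) mult_eq_assoc assoc_a_M_M)
  have "mult_coeff j p \<mu> *\<^sub>S M (Suc (i + p - \<mu>)) (j + q - \<mu>) (k + r + \<mu>) (l + s)
      = mult_coeff j p \<mu> *\<^sub>S M (Suc i + p - \<mu>) (j + q - \<mu>) (k + r + \<mu>) (l + s)" for \<mu>
    by (cases "\<mu> \<le> p") (simp_all add: mult_coeff_eq_0 Suc_diff_le)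
  then have main: "a * (\<Sum>\<mu>\<le>j. mult_coeff j p \<mu> *\<^sub>S M (i + p - \<mu>) (j + q - \<mu>) (k + r + \<mu>) (l + s))
      = (\<Sum>\<mu>\<le>j. mult_coeff j p \<mu> *\<^sub>S M (Suc i + p - \<mu>) (j + q - \<mu>) (k + r + \<mu>) (l + s))"
    by (simp only: na_sum_distrib_left scale_mult_right a_M)
  have pred: "(?\<delta> * ?x) *\<^sub>S E (Suc (i + p - 1)) (j + q - 1) (l + s - 1)
      = (?\<delta> * ?x) *\<^sub>S E (i + p) (j + q - 1) (l + s - 1)"
    by (cases i; cases p) simp_all
  have coeff: "1/6 * (of_nat (j * s) - of_nat (l * q)) + ?x
      = 1/6 * of_nat (Suc i * j * s) - 1/6 * of_nat (Suc i * l * q) + 1/2 * of_nat (j * l * p)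
        + 1/3 * of_nat (j * p * s) - 1/3 * of_nat (l * p * q)"
    by (simp add: algebra_simps)
  have "M (Suc i) j k l * M p q r s
      = (\<Sum>\<mu>\<le>j. mult_coeff j p \<mu> *\<^sub>S M (Suc i + p - \<mu>) (j + q - \<mu>) (k + r + \<mu>) (l + s))
        + (?\<delta> * (1/6 * (of_nat (j * s) - of_nat (l * q)) + ?x)) *\<^sub>S E (i + p) (j + q - 1) (l + s - 1)
        - (of_bool (k = 0) * of_bool (r = 1) * of_nat l) *\<^sub>S E (Suc (i + p)) (j + q) (l + s - 1)"
    unfolding step Suc na_distribs main scale_mult_right a_E pred distrib_left scale_left_distrib
    by (simp only: add_ac diff_conv_add_uminus)
  then show ?case
    unfolding coeff by simp
qed (simp add: M_b_mult)

end

section \<open>The quotient of the enveloping algebra\<close>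

lemma keys_free_scale: "Poly_Mapping.keys (free_scale r x) \<subseteq> Poly_Mapping.keys x"
  by (auto simp: Poly_Mapping.in_keys_iff lookup_free_scale)

lemma free_scale_single: "free_scale r (Poly_Mapping.single w s) = Poly_Mapping.single w (r * s)"
  by (rule poly_mapping_eqI) (simp add: lookup_free_scale Poly_Mapping.lookup_single when_def)

lemma free_scale_add: "free_scale r (x + y) = free_scale r x + free_scale r y"
  "free_scale (r + s) x = free_scale r x + free_scale s x"
  "free_scale r (free_scale s x) = free_scale (r * s) x"
  "free_scale 1 x = x"
  by (rule poly_mapping_eqI; simp add: lookup_free_scale Poly_Mapping.lookup_add algebra_simps)+

lemma free_scale_zero [simp]: "free_scale r 0 = 0" "free_scale 0 x = 0"
  by (rule poly_mapping_eqI; simp add: lookup_free_scale)+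

lemma free_scale_sum: "free_scale r (sum f A) = (\<Sum>x\<in>A. free_scale r (f x))"
  by (induction A rule: infinite_finite_induct) (simp_all add: free_scale_add)

lemma free_mult_scale:
  "free_mult (free_scale r x) y = free_scale r (free_mult x y)"
  "free_mult x (free_scale r y) = free_scale r (free_mult x y)"
  by (subst free_mult_superset[of "Poly_Mapping.keys x" "Poly_Mapping.keys y"];
      simp add: keys_free_scale free_mult_def free_scale_sum free_scale_single lookup_free_scale mult_ac)+

lemma free_mult_single:
  "free_mult (Poly_Mapping.single u r) (Poly_Mapping.single v s) = Poly_Mapping.single (word_mult u v) (r * s)"
  by (subst free_mult_superset[of "{u}" "{v}"]) auto

lemma sum_single_lookup:
  "finite A \<Longrightarrow> Poly_Mapping.keys x \<subseteq> A \<Longrightarrow> (\<Sum>w\<in>A. Poly_Mapping.single w (Poly_Mapping.lookup x w)) = x"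
  by (rule poly_mapping_eqI)
    (auto simp: Poly_Mapping.lookup_sum Poly_Mapping.lookup_single when_def Poly_Mapping.in_keys_iff)

lemma word_mult_None [simp]: "word_mult w None = w"
  by (cases w) auto

lemma free_mult_one: "free_mult free_one x = x" "free_mult x free_one = x"
  by (subst free_mult_superset[of "{None}" "Poly_Mapping.keys x"];
      simp add: free_one_def sum_single_lookup)
    (subst free_mult_superset[of "Poly_Mapping.keys x" "{None}"];
      simp add: free_one_def sum_single_lookup)

lemma env_mult_one: "1 * x = x" "x * 1 = (x :: 'k::field env)"
  by (transfer; simp add: free_mult_one env_ideal_def ideal_gen.zero)+

instance envJ :: (field) nonassoc_ring_1
proof
  fix x y z :: "'a envJ"
  have left: "(x - y) * z = x * z - y * z" for x y z :: "'a envJ"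
    by transfer (simp add: env_mult_diff_left J_ideal_def ideal_gen.zero)
  have right: "z * (x - y) = z * x - z * y" for x y z :: "'a envJ"
    by transfer (simp add: env_mult_diff_right J_ideal_def ideal_gen.zero)
  show "(x + y) * z = x * z + y * z"
    using left[of x "- y" z] left[of 0 y z] left[of 0 0 z] by simp
  show "x * (y + z) = x * y + x * z"
    using right[of x y "- z"] right[of x 0 z] right[of x 0 0] by simp
  show "1 * x = x" "x * 1 = x"
    by (transfer; simp add: env_mult_one J_ideal_def ideal_gen.zero)+
qed

lemma env_scale_add:
  "env_scale r (x + y) = env_scale r x + env_scale r y"
  "env_scale (r + s) x = env_scale r x + env_scale s x"
  "env_scale r (env_scale s x) = env_scale (r * s) x"
  "env_scale 1 x = x"
  by (transfer; simp add: free_scale_add env_ideal_def ideal_gen.zero)+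

lemma env_scale_mult:
  "env_scale r x * y = env_scale r (x * y)" "x * env_scale r y = env_scale r (x * y)"
  by (transfer; simp add: free_mult_scale env_ideal_def ideal_gen.zero)+

interpretation envJ: nonassoc_algebra "envJ_scale :: 'k::field \<Rightarrow> 'k envJ \<Rightarrow> 'k envJ"
  by unfold_locales
    (transfer; simp add: env_scale_add env_scale_mult J_ideal_def ideal_gen.zero)+

lift_definition envJ_gen :: "gen \<Rightarrow> 'k::field envJ" is env_gen .

lemma bracket_axis: "bracket (axis x 1) (axis y 1) = basis_bracket x y"
proof -
  have "bracket (axis x 1) (axis y 1) = (\<Sum>u\<in>UNIV. \<Sum>v\<in>UNIV. if u = x \<and> v = y then basis_bracket u v else 0)"
    unfolding bracket_def by (intro sum.cong refl) (auto simp: axis_def vec_eq_iff)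
  also have "\<dots> = (\<Sum>u\<in>UNIV. if u = x then basis_bracket u y else 0)"
    by (intro sum.cong refl) auto
  finally show ?thesis by simp
qed

lemma malcev_incl_axis [simp]: "malcev_incl (axis x 1) = free_gen x"
proof -
  have "malcev_incl (axis x 1) = (\<Sum>u\<in>UNIV. if u = x then free_gen u else 0 :: 'a free_alg)"
    unfolding malcev_incl_def by (intro sum.cong refl) (auto simp: axis_def free_scale_add)
  then show ?thesis by simp
qed

lemma malcev_incl_zero [simp]: "malcev_incl 0 = 0"
  by (simp add: malcev_incl_def)

lemma env_comm_gen:
  "free_mult (free_gen x) (free_gen y) - free_mult (free_gen y) (free_gen x)
    - malcev_incl (basis_bracket x y) \<in> env_ideal"
proof -
  have "free_mult (malcev_incl (axis x 1)) (malcev_incl (axis y 1))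
      - free_mult (malcev_incl (axis y 1)) (malcev_incl (axis x 1))
      - malcev_incl (bracket (axis x 1) (axis y 1)) \<in> (env_rels :: 'a free_alg set)"
    unfolding env_rels_def by blast
  then show ?thesis
    unfolding env_ideal_def bracket_axis malcev_incl_axis by (rule ideal_gen.base)
qed

lift_definition env_incl :: "'k::field malcev \<Rightarrow> 'k env" is malcev_incl .
lift_definition envJ_incl :: "'k::field malcev \<Rightarrow> 'k envJ" is env_incl .

lemma envJ_incl_axis: "envJ_incl (axis x 1) = envJ_gen x"
  by (simp add: envJ_incl.abs_eq env_incl.abs_eq envJ_gen.abs_eq env_gen.abs_eq)

lemma envJ_incl_zero: "envJ_incl 0 = 0"
  by (simp add: envJ_incl.abs_eq env_incl.abs_eq zero_envJ.abs_eq zero_env.abs_eq)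

lemma env_comm_gen': "env_gen x * env_gen y - env_gen y * env_gen x = env_incl (basis_bracket x y)"
  by transfer (rule env_comm_gen)

lemma envJ_comm_gen: "comm (envJ_gen x) (envJ_gen y) = envJ_incl (basis_bracket x y)"
  unfolding comm_def by transfer (simp add: env_comm_gen' J_ideal_def ideal_gen.zero)

lemma env_alternating:
  fixes x y :: "'k::field env"
  shows "associator (*) (env_gen g) x y + associator (*) x (env_gen g) y = 0"
    and "associator (*) x (env_gen g) y + associator (*) x y (env_gen g) = 0"
proof -
  have "associator free_mult (free_gen g) x y + associator free_mult x (free_gen g) y \<in> env_ideal"
    "associator free_mult x (free_gen g) y + associator free_mult x y (free_gen g) \<in> env_ideal"
    for x y :: "'k free_alg"
    unfolding env_ideal_def env_rels_def malcev_incl_axis[symmetric]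
    by (rule ideal_gen.base, blast)+
  then show "associator (*) (env_gen g) x y + associator (*) x (env_gen g) y = 0"
    "associator (*) x (env_gen g) y + associator (*) x y (env_gen g) = 0"
    unfolding associator_def by (transfer; simp)+
qed

lemma envJ_gen_alt_nucleus: "envJ_gen g \<in> alt_nucleus"
proof -
  have "associator (*) (envJ_gen g) x y + associator (*) x (envJ_gen g) y = 0"
    "associator (*) x (envJ_gen g) y + associator (*) x y (envJ_gen g) = 0" for x y :: "'a envJ"
    unfolding associator_def
    by (transfer; simp add: env_alternating[unfolded associator_def] J_ideal_def ideal_gen.zero)+
  then show ?thesis
    by (simp add: alt_nucleus_def)
qed

lemma envJ_generated:
  fixes x :: "'k::field envJ"
  assumes one: "P 1" and gen: "\<And>g. P (envJ_gen g)" and add: "\<And>x y. P x \<Longrightarrow> P y \<Longrightarrow> P (x + y)"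
    and scale: "\<And>r x. P x \<Longrightarrow> P (r \<cdot> x)" and mult: "\<And>x y. P x \<Longrightarrow> P y \<Longrightarrow> P (x * y)"
  shows "P x"
proof -
  define Q where "Q f \<longleftrightarrow> P (abs_envJ (abs_env f))" for f :: "'k free_alg"
  have Q_scale: "Q f \<Longrightarrow> Q (free_scale r f)" for r f
    using scale[of "abs_envJ (abs_env f)" r] by (simp add: Q_def env_scale.abs_eq envJ_scale.abs_eq)
  have Q_mult: "Q f \<Longrightarrow> Q h \<Longrightarrow> Q (free_mult f h)" for f h
    using mult[of "abs_envJ (abs_env f)" "abs_envJ (abs_env h)"]
    by (simp add: Q_def times_env.abs_eq times_envJ.abs_eq)
  have Q_add: "Q f \<Longrightarrow> Q h \<Longrightarrow> Q (f + h)" for f h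
    using add[of "abs_envJ (abs_env f)" "abs_envJ (abs_env h)"]
    by (simp add: Q_def plus_env.abs_eq plus_envJ.abs_eq)
  have Q_one: "Q free_one"
    using one by (simp add: Q_def one_env.abs_eq one_envJ.abs_eq)
  have "Q (Poly_Mapping.single (Some t) 1)" for t
  proof (induction t)
    case (Gen g)
    show ?case
      using gen[of g] by (simp add: Q_def envJ_gen.abs_eq env_gen.abs_eq free_gen_def)
  next
    case (Mag t u)
    then show ?case
      using Q_mult[of "Poly_Mapping.single (Some t) 1" "Poly_Mapping.single (Some u) 1"]
      by (simp add: free_mult_single)
  qed
  then have "Q (Poly_Mapping.single w 1)" for w
    using Q_one by (cases w) (auto simp: free_one_def)
  then have Q_single: "Q (Poly_Mapping.single w r)" for w r
    using Q_scale[of "Poly_Mapping.single w 1" r] by (simp add: free_scale_single)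
  have "Q (\<Sum>w\<in>A. Poly_Mapping.single w (Poly_Mapping.lookup f w))" for A and f :: "'k free_alg"
    using Q_single[of None 0]
    by (induction A rule: infinite_finite_induct) (simp_all add: Q_add Q_single)
  then have "Q f" for f
    using sum_single_lookup[of "Poly_Mapping.keys f" f, OF finite_keys order_refl] by metis
  then show ?thesis
    unfolding Q_def by (induction x rule: envJ.abs_induct) (rule env.abs_induct)
qed

lemma CHAR_neq_imp_neq_0:
  assumes "CHAR('k::field) \<noteq> 2" "CHAR('k) \<noteq> 3"
  shows "(2 :: 'k) \<noteq> 0" "(3 :: 'k) \<noteq> 0"
proof -
  have "\<not> CHAR('k) dvd n" if "n = 2 \<or> n = 3" for n
  proof
    assume dvd: "CHAR('k) dvd n"
    with that have "CHAR('k) \<le> 3" by (auto dest: dvd_imp_le)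
    then consider "CHAR('k) = 0" | "CHAR('k) = 1" | "CHAR('k) = 2" | "CHAR('k) = 3" by linarith
    then show False
      using assms dvd that by cases (auto simp: CHAR_not_1')
  qed
  then show "(2 :: 'k) \<noteq> 0" "(3 :: 'k) \<noteq> 0"
    using of_nat_eq_0_iff_char_dvd[of 2, where 'a = 'k] of_nat_eq_0_iff_char_dvd[of 3, where 'a = 'k] by auto
qed

lemma malcev_enveloping_envJ:
  assumes "CHAR('k::field) \<noteq> 2" "CHAR('k) \<noteq> 3"
  shows "malcev_enveloping (envJ_scale :: 'k \<Rightarrow> 'k envJ \<Rightarrow> 'k envJ)
    (envJ_gen GA) (envJ_gen GB) (envJ_gen GC) (envJ_gen GD) (envJ_gen GE)"
proof
  show "(2 :: 'k) \<noteq> 0" "(3 :: 'k) \<noteq> 0"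
    by (rule CHAR_neq_imp_neq_0[OF assms])+
  show "{envJ_gen GA, envJ_gen GB, envJ_gen GC, envJ_gen GD, envJ_gen GE} \<subseteq> (alt_nucleus :: 'k envJ set)"
    by (simp add: envJ_gen_alt_nucleus)
  show "envJ_gen GC * envJ_gen GE = (0 :: 'k envJ)" "envJ_gen GE * envJ_gen GE = (0 :: 'k envJ)"
    by (transfer; simp add: J_ideal_def ideal_gen.base)+
  fix P :: "'k envJ \<Rightarrow> bool" and x :: "'k envJ"
  assume P: "P 1" "\<And>g. g \<in> {envJ_gen GA, envJ_gen GB, envJ_gen GC, envJ_gen GD, envJ_gen GE} \<Longrightarrow> P g"
    "\<And>x y. P x \<Longrightarrow> P y \<Longrightarrow> P (x + y)" "\<And>r x. P x \<Longrightarrow> P (r \<cdot> x)" "\<And>x y. P x \<Longrightarrow> P y \<Longrightarrow> P (x * y)"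
  have "P (envJ_gen g)" for g
    by (rule P(2), cases g) simp_all
  then show "P x"
    by (rule envJ_generated[of P, OF P(1) _ P(3-5)])
qed (simp_all add: envJ_comm_gen envJ_incl_axis envJ_incl_zero)

lemma abs_envJ_foldr: "abs_envJ (foldr (*) xs 1) = foldr (*) (map abs_envJ xs) 1"
  by (induction xs) (simp_all add: one_envJ.abs_eq flip: times_envJ.abs_eq)

lemma mon_eq: "mon i j k l m =
  ((*) (envJ_gen GA) ^^ i) (((*) (envJ_gen GB) ^^ j) (((*) (envJ_gen GC) ^^ k)
    (((*) (envJ_gen GD) ^^ l) (((*) (envJ_gen GE) ^^ m) 1))))"
  unfolding mon.abs_eq env_monom_def abs_envJ_foldr envJ_gen.abs_eq by simp

lemma (in malcev_enveloping) E_eq: "E i j l = ((*) a ^^ i) (((*) b ^^ j) (((*) d ^^ l) e))"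
proof -
  have "E 0 0 l = ((*) d ^^ l) e" by (induction l) (simp_all add: E_Suc del: d_E, simp add: E_def)
  moreover have "E 0 j l = ((*) b ^^ j) (E 0 0 l)" by (induction j) (simp_all add: E_Suc(2) del: b_E)
  moreover have "E i j l = ((*) a ^^ i) (E 0 j l)" by (induction i) (simp_all add: E_Suc(1) del: a_E)
  ultimately show ?thesis by simp
qed

theorem theorem5p5:
  fixes i j k l p q r s :: nat
  assumes "CHAR('k::field) \<noteq> 2" and "CHAR('k) \<noteq> 3"
  shows
    "(mon i j 0 l 1 :: 'k envJ) * mon p q 0 s 1 = 0
   \<and> (mon i j k l 0 :: 'k envJ) * mon p q 0 s 1
       = of_bool (k = 0) \<cdot> mon (i + p) (j + q) 0 (l + s) 1
   \<and> (mon i j 0 l 1 :: 'k envJ) * mon p q r s 0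
       = of_bool (r = 0) \<cdot> mon (i + p) (j + q) 0 (l + s) 1
   \<and> (mon i j k l 0 :: 'k envJ) * mon p q r s 0
       = (\<Sum>\<mu> = 0..j. ((-1) ^ \<mu> * of_nat (fact \<mu>) * of_nat (j choose \<mu>) * of_nat (p choose \<mu>))
             \<cdot> mon (i + p - \<mu>) (j + q - \<mu>) (k + r + \<mu>) (l + s) 0)
         + (of_bool (k = 0) * of_bool (r = 0)
             * (1/6 * of_nat (i * j * s) - 1/6 * of_nat (i * l * q) + 1/2 * of_nat (j * l * p)
                + 1/3 * of_nat (j * p * s) - 1/3 * of_nat (l * p * q)))
             \<cdot> mon (i + p - 1) (j + q - 1) 0 (l + s - 1) 1
         - (of_bool (k = 0) * of_bool (r = 1) * of_nat l)
             \<cdot> mon (i + p) (j + q) 0 (l + s - 1) 1"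
proof -
  interpret malcev_enveloping "envJ_scale :: 'k \<Rightarrow> 'k envJ \<Rightarrow> 'k envJ"
    "envJ_gen GA" "envJ_gen GB" "envJ_gen GC" "envJ_gen GD" "envJ_gen GE"
    by (rule malcev_enveloping_envJ[OF assms])
  have M: "mon i j k l 0 = M i j k l" for i j k l
    by (simp add: mon_eq M_def)
  have E: "mon i j 0 l 1 = E i j l" for i j l
    by (simp add: mon_eq E_eq)
  show ?thesis
    unfolding M E atLeast0AtMost mult_coeff_def[symmetric]
    by (intro conjI E_E M_E E_M M_M_mult)
qed

end
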